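(* Let $G=M\bowtie_\gamma H$ be the cocycle double cross product of a cocycle matched pair $(M,H)$, with Lie algebra $T_oM\bowtie_\theta\mathfrak h$. Given a (reduced) Lagrangian $\ell=\ell(v,\eta)$ on $T_oM\bowtie_\theta\mathfrak h$, the Euler-Poincaré equations are given by $$\frac{d}{dt}\frac{\delta\ell}{\delta v}=-\mathfrak{ad}^*_v\Big(\frac{\delta\ell}{\delta v}\Big)+\Big(\frac{\delta\ell}{\delta v}\Big)\overset{*}{\triangleleft}\eta+\mathfrak a^*_\eta\Big(\frac{\delta\ell}{\delta\eta}\Big)+\theta^*_v\Big(\frac{\delta\ell}{\delta\eta}\Big),$$ $$\frac{d}{dt}\frac{\delta\ell}{\delta\eta}=-\mathrm{ad}^*_\eta\Big(\frac{\delta\ell}{\delta\eta}\Big)-\mathfrak b^*_v\Big(\frac{\delta\ell}{\delta v}\Big)-{}_v\psi^*\Big(\frac{\delta\ell}{\delta\eta}\Big).$$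
   Context: Cocycle matched pair. $M$ is a smooth manifold with a distinguished element $o$, $H$ is a Lie group (product $*$, identity $1$, Lie algebra $\mathfrak h$) with a smooth left action $H\times M\to M$, $(h,m)\mapsto h\triangleright m$, satisfying $h\triangleright o=o$. There are smooth maps $\sigma:H\times M\to H$, $\Phi:M\times M\to M$ (written $m_1\cdot m_2$), $\gamma:M\times M\to H$ with $\sigma(h,o)=h$, $\sigma(1,m)=1$, $\gamma(o,o)=1$, and (i) $o\cdot m=m=m\cdot o$; (ii) $\gamma(m,o)=1=\gamma(o,m)$; (iii) $h\triangleright(m_1\cdot m_2)=(h\triangleright m_1)\cdot(\sigma(h,m_1)\triangleright m_2)$; (iv) $\sigma(h,m_1\cdot m_2)*\gamma(m_1,m_2)=\gamma(h\triangleright m_1,\sigma(h,m_1)\triangleright m_2)*\sigma(\sigma(h,m_1),m_2)$; (v) $\sigma(h_1*h_2,m)=\sigma(h_1,h_2\triangleright m)*\sigma(h_2,m)$; (vi) $m_1\cdot(m_2\cdot m_3)=(m_1\cdot m_2)\cdot(\gamma(m_1,m_2)\triangleright m_3)$; (vii) $\gamma(m_1,m_2\cdot m_3)*\gamma(m_2,m_3)=\gamma(m_1\cdot m_2,\gamma(m_1,m_2)\triangleright m_3)*\sigma(\gamma(m_1,m_2),m_3)$; (viii) for each $m\in M$ there is $m^r\in M$ with $m\cdot m^r=o$. Then (known) $M\bowtie_\gamma H:=M\times H$ is a Lie group with identity $(o,1)$ and product $$(m_1,h_1)(m_2,h_2)=\big(m_1\cdot(h_1\triangleright m_2),\ \gamma(m_1,h_1\triangleright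 m_2)*\sigma(h_1,m_2)*h_2\big),$$ called the cocycle double cross product. Lie algebra. The Lie algebra of $G=M\bowtie_\gamma H$ is $T_oM\oplus\mathfrak h$ as a vector space, with $\mathfrak h$ a subalgebra; it is denoted $T_oM\bowtie_\theta\mathfrak h$. Define bilinear maps by decomposing brackets into components in $T_oM$ and $\mathfrak h$: $[\eta,v]=\eta\triangleright v+\psi(\eta,v)$ and $[v_1,v_2]=[[v_1,v_2]]+\theta(v_1,v_2)$ for $v,v_1,v_2\in T_oM$, $\eta\in\mathfrak h$. Thus $$[(v_1,\eta_1),(v_2,\eta_2)]=\big([[v_1,v_2]]+\eta_1\triangleright v_2-\eta_2\triangleright v_1,\ [\eta_1,\eta_2]+\psi(\eta_1,v_2)-\psi(\eta_2,v_1)+\theta(v_1,v_2)\big).$$ Maps. For $\alpha\in T_o^*M$: $\langle\alpha\overset{*}{\triangleleft}\eta,w\rangle=\langle\alpha,\eta\triangleright w\rangle$. The linear maps $\mathfrak a_\eta:T_oM\to\mathfrak h$, $v\mapsto\psi(\eta,v)$; $\mathfrak b_v:\mathfrak h\to T_oM$, $\eta\mapsto\eta\triangleright v$; ${}_v\psi:\mathfrak h\to\mathfrak h$, $\eta\mapsto\psi(\eta,v)$; $\theta_v:T_oM\to\mathfrak h$, $w\mapsto\theta(v,w)$ have transposes $\mathfrak a_\eta^*,\mathfrak b_v^*,{}_v\psi^*,\theta_v^*$ (no sign). In contrast $\langle\mathfrak{ad}^*_v\alpha,w\rangle=-\langle\alpha,[[v,w]]\rangle$ and, for any Lie algebra,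 $\langle\mathrm{ad}^*_\xi\mu,\zeta\rangle=-\langle\mu,[\xi,\zeta]\rangle$. Euler-Poincaré equations. For a Lie algebra $\mathfrak g$ and $\ell=\ell(\xi)$ on $\mathfrak g$ these are $\frac{d}{dt}\frac{\delta\ell}{\delta\xi}=-\mathrm{ad}^*_\xi\big(\frac{\delta\ell}{\delta\xi}\big)$, where $\delta\ell/\delta\xi\in\mathfrak g^*$ is the derivative of $\ell$. In the claim $\xi=(v,\eta)$, $\delta\ell/\delta v\in T_o^*M$, $\delta\ell/\delta\eta\in\mathfrak h^*$. *)

theory Defs
  imports "HOL-Analysis.Analysis" "HOL-Library.Function_Algebras"
begin

text \<open>Tangent vectors and covectors below are functionals; they are added and scaled pointwise.\<close>

instantiation "fun" :: (type, real_vector) real_vector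
begin

definition scaleR_fun :: "real \<Rightarrow> ('a \<Rightarrow> 'b) \<Rightarrow> 'a \<Rightarrow> 'b"
  where "scaleR_fun r f = (\<lambda>x. r *\<^sub>R f x)"

instance
  by standard (auto simp: scaleR_fun_def plus_fun_def fun_eq_iff algebra_simps)

end

text \<open>\<open>C\<^sup>\<infinity>\<close> maps on an open subset of a finite-dimensional space: all iterated directional
  derivatives up to order \<open>k\<close> exist and are continuous, for every \<open>k\<close>.\<close>

primrec Ck_on :: "nat \<Rightarrow> 'a::real_normed_vector set \<Rightarrow> ('a \<Rightarrow> 'b::real_normed_vector) \<Rightarrow> bool"
  where
    "Ck_on 0 S f \<longleftrightarrow> continuous_on S f"
  | "Ck_on (Suc k) S f \<longleftrightarrow>
       (\<forall>x\<in>S. f differentiable (at x)) \<and>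
       (\<forall>v. Ck_on k S (\<lambda>x. frechet_derivative f (at x) v))"

definition smooth_on :: "'a::real_normed_vector set \<Rightarrow> ('a \<Rightarrow> 'b::real_normed_vector) \<Rightarrow> bool"
  where "smooth_on S f \<longleftrightarrow> (\<forall>k. Ck_on k S f)"

text \<open>A manifold is a whole type with its topology, together with a (not necessarily maximal)
  smooth atlas. The model space is a finite-dimensional inner product space rather than a member of
  class \<open>euclidean_space\<close>, because the latter excludes dimension \<open>0\<close>.
  The map of a chart is only meaningful on its domain.\<close>

type_synonym ('m, 'e) chart = "'m set \<times> ('m \<Rightarrow> 'e)"

definition is_chart :: "('m::topological_space, 'e::real_inner) chart \<Rightarrow> bool"
  where "is_chart = (\<lambda>(U, \<phi>). open U \<and> open (\<phi> ` U) \<and> homeomorphism U (\<phi> ` U) \<phi> (inv_into U \<phi>))"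

definition smooth_manifold ::
    "('m::{t2_space, second_countable_topology}, 'e::real_inner) chart set \<Rightarrow> bool"
  where "smooth_manifold A \<longleftrightarrow>
    (\<exists>B::'e set. finite B \<and> span B = UNIV) \<and>
    (\<forall>c\<in>A. is_chart c) \<and>
    (\<Union>(fst ` A) = UNIV) \<and>
    (\<forall>(U, \<phi>)\<in>A. \<forall>(V, \<psi>)\<in>A. smooth_on (\<phi> ` (U \<inter> V)) (\<psi> \<circ> inv_into U \<phi>))"

definition smooth_map_on ::
    "('m::topological_space, 'e::real_inner) chart set \<Rightarrow>
     ('n::topological_space, 'f::real_inner) chart set \<Rightarrow> 'm set \<Rightarrow> ('m \<Rightarrow> 'n) \<Rightarrow> bool"
  where "smooth_map_on A B W f \<longleftrightarrow>
    open W \<and> continuous_on W f \<and>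
    (\<forall>(U, \<phi>)\<in>A. \<forall>(V, \<psi>)\<in>B.
       smooth_on (\<phi> ` {x \<in> U \<inter> W. f x \<in> V}) (\<psi> \<circ> f \<circ> inv_into U \<phi>))"

abbreviation smooth_map ::
    "('m::topological_space, 'e::real_inner) chart set \<Rightarrow>
     ('n::topological_space, 'f::real_inner) chart set \<Rightarrow> ('m \<Rightarrow> 'n) \<Rightarrow> bool"
  where "smooth_map A B f \<equiv> smooth_map_on A B UNIV f"

definition smooth_near ::
    "('m::topological_space, 'e::real_inner) chart set \<Rightarrow>
     ('n::topological_space, 'f::real_inner) chart set \<Rightarrow> 'm \<Rightarrow> ('m \<Rightarrow> 'n) \<Rightarrow> bool"
  where "smooth_near A B p f \<longleftrightarrow> (\<exists>W. p \<in> W \<and> smooth_map_on A B W f)"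

definition real_atlas :: "(real, real) chart set"
  where "real_atlas = {(UNIV, \<lambda>x. x)}"

definition prod_atlas ::
    "('m, 'e) chart set \<Rightarrow> ('n, 'f) chart set \<Rightarrow> ('m \<times> 'n, 'e \<times> 'f) chart set"
  where "prod_atlas A B = {(U \<times> V, map_prod \<phi> \<psi>) | U \<phi> V \<psi>. (U, \<phi>) \<in> A \<and> (V, \<psi>) \<in> B}"

text \<open>A tangent vector at \<open>p\<close> is the velocity of a smooth curve \<open>c\<close> with \<open>c 0 = p\<close>, viewed as the
  operator \<open>f \<mapsto> (f \<circ> c)' 0\<close> on functions that are smooth near \<open>p\<close>. It is set to \<open>0\<close> on all other
  functions, so that equality of tangent vectors is equality of HOL functions.\<close>

type_synonym 'm tvec = "('m \<Rightarrow> real) \<Rightarrow> real"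
type_synonym 'm covec = "'m tvec \<Rightarrow> real"

definition velocity ::
    "('m::topological_space, 'e::real_inner) chart set \<Rightarrow> (real \<Rightarrow> 'm) \<Rightarrow> 'm tvec"
  where "velocity A c =
    (\<lambda>f. if smooth_near A real_atlas (c 0) f then deriv (\<lambda>s. f (c s)) 0 else 0)"

definition tangent_space ::
    "('m::topological_space, 'e::real_inner) chart set \<Rightarrow> 'm \<Rightarrow> 'm tvec set"
  where "tangent_space A p = {velocity A c | c. c 0 = p \<and> smooth_near real_atlas A 0 c}"

definition pushforward ::
    "('n::topological_space, 'f::real_inner) chart set \<Rightarrow> ('m \<Rightarrow> 'n) \<Rightarrow> 'm \<Rightarrow> 'm tvec \<Rightarrow> 'n tvec"
  where "pushforward B \<Phi> p X =
    (\<lambda>f. if smooth_near B real_atlas (\<Phi> p) f then X (f \<circ> \<Phi>) else 0)"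

record ('g, 'e) lie_group_data =
  atlas :: "('g, 'e) chart set"
  mult :: "'g \<Rightarrow> 'g \<Rightarrow> 'g"
  neutral :: 'g

definition lie_group ::
    "('g::{t2_space, second_countable_topology}, 'e::real_inner) lie_group_data \<Rightarrow> bool"
  where "lie_group G \<longleftrightarrow>
    smooth_manifold (atlas G) \<and>
    smooth_map (prod_atlas (atlas G) (atlas G)) (atlas G) (\<lambda>(x, y). mult G x y) \<and>
    (\<exists>inv. group (mult G) (neutral G) inv \<and> smooth_map (atlas G) (atlas G) inv)"

definition lie_algebra ::
    "('g::topological_space, 'e::real_inner) lie_group_data \<Rightarrow> 'g tvec set"
  where "lie_algebra G = tangent_space (atlas G) (neutral G)"

definition left_invariant_field :: "('g, 'e) lie_group_data \<Rightarrow> 'g tvec \<Rightarrow> ('g \<Rightarrow> real) \<Rightarrow> 'g \<Rightarrow> real"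
  where "left_invariant_field G \<xi> F = (\<lambda>g. \<xi> (\<lambda>x. F (mult G g x)))"

text \<open>The value at the identity of the commutator of the left invariant fields of \<open>\<xi>\<close> and \<open>\<zeta>\<close>.\<close>

definition lie_bracket ::
    "('g::topological_space, 'e::real_inner) lie_group_data \<Rightarrow> 'g tvec \<Rightarrow> 'g tvec \<Rightarrow> 'g tvec"
  where "lie_bracket G \<xi> \<zeta> =
    (\<lambda>F. if smooth_near (atlas G) real_atlas (neutral G) F
         then \<xi> (left_invariant_field G \<zeta> F) - \<zeta> (left_invariant_field G \<xi> F) else 0)"

record ('m, 'e, 'h, 'f) matched_pair_data =
  base_atlas :: "('m, 'e) chart set"
  base_point :: 'm
  fibre :: "('h, 'f) lie_group_data"
  act :: "'h \<Rightarrow> 'm \<Rightarrow> 'm"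
  sig :: "'h \<Rightarrow> 'm \<Rightarrow> 'h"
  dot :: "'m \<Rightarrow> 'm \<Rightarrow> 'm"
  gam :: "'m \<Rightarrow> 'm \<Rightarrow> 'h"

locale cocycle_matched_pair =
  fixes P :: "('m::{t2_space, second_countable_topology}, 'e::real_inner,
    'h::{t2_space, second_countable_topology}, 'f::real_inner) matched_pair_data"
  assumes manifold: "smooth_manifold (base_atlas P)"
    and group: "lie_group (fibre P)"
    and act_smooth: "smooth_map (prod_atlas (atlas (fibre P)) (base_atlas P)) (base_atlas P)
      (\<lambda>(h, m). act P h m)"
    and sig_smooth: "smooth_map (prod_atlas (atlas (fibre P)) (base_atlas P)) (atlas (fibre P))
      (\<lambda>(h, m). sig P h m)"
    and dot_smooth: "smooth_map (prod_atlas (base_atlas P) (base_atlas P)) (base_atlas P)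
      (\<lambda>(m, n). dot P m n)"
    and gam_smooth: "smooth_map (prod_atlas (base_atlas P) (base_atlas P)) (atlas (fibre P))
      (\<lambda>(m, n). gam P m n)"
    and act_neutral: "act P (neutral (fibre P)) m = m"
    and act_mult: "act P (mult (fibre P) h k) m = act P h (act P k m)"
    and act_base: "act P h (base_point P) = base_point P"
    and sig_base: "sig P h (base_point P) = h"
    and sig_neutral: "sig P (neutral (fibre P)) m = neutral (fibre P)"
    and gam_base: "gam P (base_point P) (base_point P) = neutral (fibre P)"
    and dot_base_left: "dot P (base_point P) m = m"
    and dot_base_right: "dot P m (base_point P) = m"
    and gam_base_right: "gam P m (base_point P) = neutral (fibre P)"
    and gam_base_left: "gam P (base_point P) m = neutral (fibre P)"
    and act_dot: "act P h (dot P m1 m2) = dot P (act P h m1) (act P (sig P h m1) m2)"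
    and sig_dot: "mult (fibre P) (sig P h (dot P m1 m2)) (gam P m1 m2) =
      mult (fibre P) (gam P (act P h m1) (act P (sig P h m1) m2)) (sig P (sig P h m1) m2)"
    and sig_mult: "sig P (mult (fibre P) h1 h2) m =
      mult (fibre P) (sig P h1 (act P h2 m)) (sig P h2 m)"
    and dot_assoc: "dot P m1 (dot P m2 m3) = dot P (dot P m1 m2) (act P (gam P m1 m2) m3)"
    and gam_cocycle: "mult (fibre P) (gam P m1 (dot P m2 m3)) (gam P m2 m3) =
      mult (fibre P) (gam P (dot P m1 m2) (act P (gam P m1 m2) m3)) (sig P (gam P m1 m2) m3)"
    and right_inverse: "\<exists>m'. dot P m m' = base_point P"

definition double_cross ::
    "('m, 'e, 'h, 'f) matched_pair_data \<Rightarrow> ('m \<times> 'h, 'e \<times> 'f) lie_group_data"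
  where "double_cross P =
    \<lparr>atlas = prod_atlas (base_atlas P) (atlas (fibre P)),
     mult = (\<lambda>(m1, h1) (m2, h2).
       (dot P m1 (act P h1 m2),
        mult (fibre P) (mult (fibre P) (gam P m1 (act P h1 m2)) (sig P h1 m2)) h2)),
     neutral = (base_point P, neutral (fibre P))\<rparr>"

abbreviation tangent_base ::
    "('m::topological_space, 'e::real_inner, 'h, 'f) matched_pair_data \<Rightarrow> 'm tvec set"
  where "tangent_base P \<equiv> tangent_space (base_atlas P) (base_point P)"

text \<open>The identification of \<open>T\<^sub>o M \<oplus> \<hh>\<close> with the tangent space of \<open>M \<times> H\<close> at the identity: the sum of
  the differentials of the two inclusions, with inverse the differentials of the projections.\<close>

definition join_tangent ::
    "('m::topological_space, 'e::real_inner, 'h::topological_space, 'f::real_inner) matched_pair_data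
      \<Rightarrow> 'm tvec \<times> 'h tvec \<Rightarrow> ('m \<times> 'h) tvec"
  where "join_tangent P = (\<lambda>(v, \<eta>).
    pushforward (atlas (double_cross P)) (\<lambda>m. (m, neutral (fibre P))) (base_point P) v +
    pushforward (atlas (double_cross P)) (\<lambda>h. (base_point P, h)) (neutral (fibre P)) \<eta>)"

definition split_tangent ::
    "('m::topological_space, 'e::real_inner, 'h::topological_space, 'f::real_inner) matched_pair_data
      \<Rightarrow> ('m \<times> 'h) tvec \<Rightarrow> 'm tvec \<times> 'h tvec"
  where "split_tangent P X =
    (pushforward (base_atlas P) fst (neutral (double_cross P)) X,
     pushforward (atlas (fibre P)) snd (neutral (double_cross P)) X)"

definition dc_algebra ::
    "('m::topological_space, 'e::real_inner, 'h::topological_space, 'f::real_inner) matched_pair_data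
      \<Rightarrow> ('m tvec \<times> 'h tvec) set"
  where "dc_algebra P = tangent_base P \<times> lie_algebra (fibre P)"

definition dc_bracket ::
    "('m::topological_space, 'e::real_inner, 'h::topological_space, 'f::real_inner) matched_pair_data
      \<Rightarrow> 'm tvec \<times> 'h tvec \<Rightarrow> 'm tvec \<times> 'h tvec \<Rightarrow> 'm tvec \<times> 'h tvec"
  where "dc_bracket P x y =
    split_tangent P (lie_bracket (double_cross P) (join_tangent P x) (join_tangent P y))"

text \<open>The components of the brackets:
  \<open>[\<eta>, v] = \<eta> \<triangleright> v + \<psi>(\<eta>, v)\<close> and \<open>[v, w] = [[v, w]] + \<theta>(v, w)\<close>.\<close>

definition inf_act ::
    "('m::topological_space, 'e::real_inner, 'h::topological_space, 'f::real_inner) matched_pair_data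
      \<Rightarrow> 'h tvec \<Rightarrow> 'm tvec \<Rightarrow> 'm tvec"
  where "inf_act P \<eta> v = fst (dc_bracket P (0, \<eta>) (v, 0))"

definition inf_psi ::
    "('m::topological_space, 'e::real_inner, 'h::topological_space, 'f::real_inner) matched_pair_data
      \<Rightarrow> 'h tvec \<Rightarrow> 'm tvec \<Rightarrow> 'h tvec"
  where "inf_psi P \<eta> v = snd (dc_bracket P (0, \<eta>) (v, 0))"

definition base_bracket ::
    "('m::topological_space, 'e::real_inner, 'h::topological_space, 'f::real_inner) matched_pair_data
      \<Rightarrow> 'm tvec \<Rightarrow> 'm tvec \<Rightarrow> 'm tvec"
  where "base_bracket P v w = fst (dc_bracket P (v, 0) (w, 0))"

definition inf_theta ::
    "('m::topological_space, 'e::real_inner, 'h::topological_space, 'f::real_inner) matched_pair_data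
      \<Rightarrow> 'm tvec \<Rightarrow> 'm tvec \<Rightarrow> 'h tvec"
  where "inf_theta P v w = snd (dc_bracket P (v, 0) (w, 0))"

definition map_a ::
    "('m::topological_space, 'e::real_inner, 'h::topological_space, 'f::real_inner) matched_pair_data
      \<Rightarrow> 'h tvec \<Rightarrow> 'm tvec \<Rightarrow> 'h tvec"
  where "map_a P \<eta> = (\<lambda>v. inf_psi P \<eta> v)"

definition map_b ::
    "('m::topological_space, 'e::real_inner, 'h::topological_space, 'f::real_inner) matched_pair_data
      \<Rightarrow> 'm tvec \<Rightarrow> 'h tvec \<Rightarrow> 'm tvec"
  where "map_b P v = (\<lambda>\<eta>. inf_act P \<eta> v)"

definition map_psi ::
    "('m::topological_space, 'e::real_inner, 'h::topological_space, 'f::real_inner) matched_pair_data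
      \<Rightarrow> 'm tvec \<Rightarrow> 'h tvec \<Rightarrow> 'h tvec"
  where "map_psi P v = (\<lambda>\<eta>. inf_psi P \<eta> v)"

definition map_theta ::
    "('m::topological_space, 'e::real_inner, 'h::topological_space, 'f::real_inner) matched_pair_data
      \<Rightarrow> 'm tvec \<Rightarrow> 'm tvec \<Rightarrow> 'h tvec"
  where "map_theta P v = (\<lambda>w. inf_theta P v w)"

text \<open>Elements of the dual of a space \<open>V\<close> of tangent vectors are represented by functions whose values
  matter only on \<open>V\<close>.\<close>

definition transpose_map :: "('a \<Rightarrow> 'b) \<Rightarrow> ('b \<Rightarrow> real) \<Rightarrow> 'a \<Rightarrow> real"
  where "transpose_map L \<beta> = (\<lambda>w. \<beta> (L w))"

definition coad :: "('a \<Rightarrow> 'a \<Rightarrow> 'a) \<Rightarrow> 'a \<Rightarrow> ('a \<Rightarrow> real) \<Rightarrow> 'a \<Rightarrow> real"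
  where "coad br \<xi> \<mu> = (\<lambda>\<zeta>. - \<mu> (br \<xi> \<zeta>))"

definition coact ::
    "('m::topological_space, 'e::real_inner, 'h::topological_space, 'f::real_inner) matched_pair_data
      \<Rightarrow> 'm covec \<Rightarrow> 'h tvec \<Rightarrow> 'm covec"
  where "coact P \<alpha> \<eta> = (\<lambda>w. \<alpha> (inf_act P \<eta> w))"

definition vderiv :: "('a::real_vector \<Rightarrow> real) \<Rightarrow> 'a \<Rightarrow> 'a \<Rightarrow> real"
  where "vderiv l \<xi> = (\<lambda>\<zeta>. deriv (\<lambda>s. l (\<xi> + s *\<^sub>R \<zeta>)) 0)"

text \<open>\<open>d\<alpha>/dt = \<beta>\<close> at time \<open>t\<close>, in the dual of the finite-dimensional space \<open>V\<close>, where norm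
  differentiability is the same as differentiability of the pairing with every vector.\<close>

definition dual_deriv ::
    "'a set \<Rightarrow> (real \<Rightarrow> 'a \<Rightarrow> real) \<Rightarrow> ('a \<Rightarrow> real) \<Rightarrow> real \<Rightarrow> real set \<Rightarrow> bool"
  where "dual_deriv V \<alpha> \<beta> t I \<longleftrightarrow>
    (\<forall>w\<in>V. ((\<lambda>s. \<alpha> s w) has_real_derivative \<beta> w) (at t within I))"

definition euler_poincare ::
    "'a::real_vector set \<Rightarrow> ('a \<Rightarrow> 'a \<Rightarrow> 'a) \<Rightarrow> ('a \<Rightarrow> real) \<Rightarrow> (real \<Rightarrow> 'a) \<Rightarrow> real \<Rightarrow> real set \<Rightarrow> bool"
  where "euler_poincare V br l \<xi> t I \<longleftrightarrow>
    dual_deriv V (\<lambda>s. vderiv l (\<xi> s)) (- coad br (\<xi> t) (vderiv l (\<xi> t))) t I"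

text \<open>A differentiable function on \<open>T\<^sub>o M \<oplus> \<hh>\<close>: differentiable in linear coordinates. The model space
  \<open>'e \<times> 'f\<close> of \<open>M \<times> H\<close> has the dimension of \<open>T\<^sub>o M \<oplus> \<hh>\<close>; the choice of \<open>L\<close> is immaterial.\<close>

definition lagrangian ::
    "('m::topological_space, 'e::real_inner, 'h::topological_space, 'f::real_inner) matched_pair_data
      \<Rightarrow> ('m tvec \<times> 'h tvec \<Rightarrow> real) \<Rightarrow> bool"
  where "lagrangian P l \<longleftrightarrow>
    (\<exists>L::'e \<times> 'f \<Rightarrow> 'm tvec \<times> 'h tvec.
       linear L \<and> bij_betw L UNIV (dc_algebra P) \<and> (\<forall>x. (l \<circ> L) differentiable (at x)))"

end

theory Submission
  imports Defs
begin

text \<open>Pairing the Euler-Poincare equation with a vector \<open>(w, \<kappa>)\<close> turns its right-hand side into the value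
  of the derivative of the Lagrangian on the bracket \<open>[(v, \<eta>), (w, \<kappa>)]\<close>. That derivative is linear on
  \<open>T\<^sub>o M \<oplus> \<hh>\<close>, and so it is the sum of the two partial derivatives. Testing with the vectors \<open>(w, 0)\<close>
  and \<open>(0, \<kappa>)\<close> separates the two equations, and in each of them the bracket is expanded into brackets of
  pure components: \<open>[(v, \<eta>), (w, 0)] = [v, w] + [\<eta>, w]\<close> and \<open>[(v, \<eta>), (0, \<kappa>)] = [\<eta>, \<kappa>] - [\<kappa>, v]\<close>.
  By definition \<open>[v, w]\<close> has the components \<open>[[v, w]]\<close> and \<open>\<theta>(v, w)\<close>, and \<open>[\<eta>, w]\<close> has the components
  \<open>\<eta> \<triangleright> w\<close> and \<open>\<psi>(\<eta>, w)\<close>. This gives every term except the coadjoint action of \<open>\<hh>\<close>, for which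
  \<open>[\<eta>, \<kappa>]\<close> has to be the bracket of the Lie group \<open>H\<close>.

  Most of the work is the differential geometry behind this expansion. The bracket of two velocities is
  introduced as a commutator of operators on functions, so it has to be shown that it is again a
  velocity and that it is additive in each argument. Both follow from a formula in a chart. There
  the left invariant field of a tangent vector \<open>z\<close> is a smooth field \<open>Z\<^sub>z\<close> with \<open>Z\<^sub>z(x\<^sub>0) = z\<close> that depends
  linearly on \<open>z\<close>; the second derivatives of the test function cancel by symmetry, and the tangent vector
  \<open>DZ\<^sub>z(x\<^sub>0) y - DZ\<^sub>y(x\<^sub>0) z\<close> remains (\<open>lie_bracket_in_chart\<close>). The formula rests on a smooth
  multiplication with a two-sided unit, which \<open>M \<times> H\<close> has because the maps of the matched pair are smooth
  and normalised at the base point and at the unit.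

  That \<open>\<hh>\<close> is a subalgebra comes from \<open>(m, k)(o, h) = (m, k h)\<close>: the left invariant field of an element
  of \<open>\<hh>\<close> kills functions of \<open>m\<close>, and on functions of \<open>h\<close> it acts as the corresponding field on \<open>H\<close>
  (\<open>dc_bracket_fibre\<close>).\<close>

section \<open>Calculus of smooth maps on finite-dimensional spaces\<close>

text \<open>Coordinates on a finite-dimensional inner product space, in the form in which they are used: as an
  expansion of vectors (a Parseval frame). The empty frame covers dimension \<open>0\<close>.\<close>

definition tight_frame :: "'a::real_inner set \<Rightarrow> bool"
  where "tight_frame B \<longleftrightarrow> finite B \<and> (\<forall>x. x = (\<Sum>b\<in>B. (x \<bullet> b) *\<^sub>R b))"

lemma tight_frame_linear_expansion:
  fixes L :: "'a::real_inner \<Rightarrow> 'b::real_vector" and B :: "'a set"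
  assumes "tight_frame B" "linear L"
  shows "L x = (\<Sum>b\<in>B. (x \<bullet> b) *\<^sub>R L b)"
proof -
  have "L x = L (\<Sum>b\<in>B. (x \<bullet> b) *\<^sub>R b)"
    using assms(1) unfolding tight_frame_def by metis
  then show ?thesis
    using assms(2) by (simp add: linear_sum linear_cmul)
qed

text \<open>Normalising an orthogonal spanning set, after discarding \<open>0\<close>, gives a frame.\<close>

lemma tight_frame_exists:
  fixes S :: "'a::real_inner set"
  assumes "finite S" "span S = UNIV"
  obtains B :: "'a set" where "tight_frame B"
proof -
  obtain C where C: "finite C" "span C = span S" "pairwise orthogonal C"
    using basis_orthogonal[OF assms(1)] by blast
  define B where "B = (\<lambda>c. c /\<^sub>R norm c) ` (C - {0})"
  have inj: "inj_on (\<lambda>c. c /\<^sub>R norm c) (C - {0})"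
  proof (rule inj_onI)
    fix x y assume xy: "x \<in> C - {0}" "y \<in> C - {0}" "x /\<^sub>R norm x = y /\<^sub>R norm y"
    then have "(x /\<^sub>R norm x) \<bullet> (y /\<^sub>R norm y) = 1"
      by (metis DiffE dot_square_norm insertCI norm_sgn one_power2 sgn_div_norm)
    then have "\<not> orthogonal x y" by (auto simp: orthogonal_def)
    then show "x = y" using C(3) xy by (auto simp: pairwise_def)
  qed
  have "x = (\<Sum>b\<in>B. (x \<bullet> b) *\<^sub>R b)" for x
  proof -
    have "x \<in> span C" using assms C by auto
    then have "x = (\<Sum>c\<in>C - {0}. (x \<bullet> c / (c \<bullet> c)) *\<^sub>R c)"
    proof (induct rule: span_induct_alt)
      case base show ?case by simp
    next
      case (step r c y)
      have "(\<Sum>d\<in>C - {0}. (c \<bullet> d / (d \<bullet> d)) *\<^sub>R d) = c"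
      proof (cases "c = 0")
        case True then show ?thesis by simp
      next
        case False
        then have "(\<Sum>d\<in>C - {0}. (c \<bullet> d / (d \<bullet> d)) *\<^sub>R d)
            = (\<Sum>d\<in>C - {0}. if d = c then c else 0)"
          using C(3) step(1) by (intro sum.cong) (auto simp: pairwise_def orthogonal_def)
        then show ?thesis using False step C(1) by simp
      qed
      moreover have "(\<Sum>d\<in>C - {0}. ((r *\<^sub>R c + y) \<bullet> d / (d \<bullet> d)) *\<^sub>R d)
        = r *\<^sub>R (\<Sum>d\<in>C - {0}. (c \<bullet> d / (d \<bullet> d)) *\<^sub>R d) + (\<Sum>d\<in>C - {0}. (y \<bullet> d / (d \<bullet> d)) *\<^sub>R d)"
        by (simp add: scaleR_sum_right sum.distrib[symmetric] inner_add_left add_divide_distrib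
            scaleR_add_left)
      ultimately show ?case using step(2) by simp
    qed
    also have "\<dots> = (\<Sum>c\<in>C - {0}. (x \<bullet> (c /\<^sub>R norm c)) *\<^sub>R (c /\<^sub>R norm c))"
      by (intro sum.cong) (auto simp: dot_square_norm power2_eq_square field_simps)
    finally show ?thesis
      unfolding B_def sum.reindex[OF inj] by simp
  qed
  then have "tight_frame B" using C(1) by (simp add: tight_frame_def B_def)
  then show ?thesis using that by blast
qed

lemma Ck_on_Suc_has_derivative:
  assumes "Ck_on (Suc k) S f" "x \<in> S"
  shows "(f has_derivative frechet_derivative f (at x)) (at x)"
  using assms by (simp add: frechet_derivative_works[symmetric])

lemma Ck_on_cong:
  assumes "open S" "\<And>x. x \<in> S \<Longrightarrow> f x = g x" "Ck_on k S f"
  shows "Ck_on k S g"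
  using assms(2,3)
proof (induct k arbitrary: f g)
  case 0 then show ?case by (metis Ck_on.simps(1) continuous_on_cong)
next
  case (Suc k)
  have "(g has_derivative frechet_derivative f (at x)) (at x)" if "x \<in> S" for x
    by (rule has_derivative_transform_within_open[OF
          Ck_on_Suc_has_derivative[OF Suc.prems(2) that] assms(1) that Suc.prems(1)])
  then have diff: "g differentiable at x"
    and eq: "frechet_derivative f (at x) = frechet_derivative g (at x)"
    if "x \<in> S" for x
    using that differentiableI frechet_derivative_at by blast+
  have "Ck_on k S (\<lambda>x. frechet_derivative g (at x) v)" for v
    by (rule Suc.hyps[of "\<lambda>x. frechet_derivative f (at x) v"]) (use Suc.prems(2) eq in auto)
  then show ?case using diff by simp
qed

lemma Ck_on_SucI:
  assumes "open S" "\<And>x. x \<in> S \<Longrightarrow> (f has_derivative f' x) (at x)"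
    and "\<And>v. Ck_on k S (\<lambda>x. f' x v)"
  shows "Ck_on (Suc k) S f"
proof -
  have eq: "f' x = frechet_derivative f (at x)" if "x \<in> S" for x
    by (rule frechet_derivative_at[OF assms(2)[OF that]])
  have "Ck_on k S (\<lambda>x. frechet_derivative f (at x) v)" for v
    by (rule Ck_on_cong[OF assms(1) _ assms(3)[of v]]) (simp add: eq)
  moreover have "f differentiable at x" if "x \<in> S" for x
    using assms(2)[OF that] by (rule differentiableI)
  ultimately show ?thesis by simp
qed



lemma Ck_on_mono: "Ck_on k S f \<Longrightarrow> T \<subseteq> S \<Longrightarrow> Ck_on k T f"
  by (induct k arbitrary: f) (auto intro: continuous_on_subset)

lemma Ck_on_Suc_imp: "Ck_on (Suc k) S f \<Longrightarrow> Ck_on k S f"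
proof (induct k arbitrary: f)
  case 0
  then show ?case
    by (auto intro!: differentiable_imp_continuous_on differentiable_at_imp_differentiable_on)
next
  case (Suc k) then show ?case by simp
qed

lemma Ck_on_local:
  assumes "\<And>x. x \<in> S \<Longrightarrow> \<exists>T. open T \<and> x \<in> T \<and> Ck_on k T f"
  shows "Ck_on k S f"
  using assms
proof (induct k arbitrary: f)
  case 0
  have "continuous (at x) f" if "x \<in> S" for x
  proof -
    obtain T where "open T \<and> x \<in> T \<and> Ck_on 0 T f" using 0 \<open>x \<in> S\<close> by blast
    then have "open T" "x \<in> T" "continuous_on T f" by simp_all
    then show ?thesis using continuous_on_eq_continuous_at by blast
  qed
  then show ?case
    by (simp add: continuous_at_imp_continuous_on)
next
  case (Suc k)
  have "f differentiable at x" if x: "x \<in> S" for x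
  proof -
    obtain T where "x \<in> T" "Ck_on (Suc k) T f" using Suc.prems[OF x] by blast
    then show ?thesis by simp
  qed
  moreover have "Ck_on k S (\<lambda>x. frechet_derivative f (at x) v)" for v
  proof (rule Suc.hyps)
    fix x assume "x \<in> S"
    then obtain T where "open T" "x \<in> T" "Ck_on (Suc k) T f" using Suc.prems by blast
    then show "\<exists>T. open T \<and> x \<in> T \<and> Ck_on k T (\<lambda>x. frechet_derivative f (at x) v)"
      by auto
  qed
  ultimately show ?case by simp
qed

lemma Ck_on_const: "open S \<Longrightarrow> Ck_on k S (\<lambda>x. c)"
  by (induct k arbitrary: c) (auto intro!: continuous_on_const)

lemma Ck_on_bounded_linear:
  assumes "open S" "bounded_linear L"
  shows "Ck_on k S L"
proof (cases k)
  case 0 then show ?thesis using assms by (simp add: linear_continuous_on)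
next
  case (Suc j)
  have "Ck_on (Suc j) S L"
    by (rule Ck_on_SucI[OF assms(1), where f' = "\<lambda>_. L"])
      (use assms in \<open>auto intro: Ck_on_const bounded_linear_imp_has_derivative\<close>)
  then show ?thesis using Suc by simp
qed

lemma Ck_on_bounded_linear_comp:
  assumes "open S" "bounded_linear L" "Ck_on k S f"
  shows "Ck_on k S (\<lambda>x. L (f x))"
  using assms(3)
proof (induct k arbitrary: f)
  case 0
  then show ?case
    by (auto intro: bounded_linear.continuous_on[OF assms(2)])
next
  case (Suc k)
  show ?case
    by (rule Ck_on_SucI[OF assms(1), where f' = "\<lambda>x v. L (frechet_derivative f (at x) v)"])
     (use Suc Ck_on_Suc_has_derivative in
       \<open>auto intro!: bounded_linear.has_derivative[OF assms(2)] simp: frechet_derivative_works[symmetric]\<close>)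
qed

lemma Ck_on_add:
  assumes "open S" "Ck_on k S f" "Ck_on k S g"
  shows "Ck_on k S (\<lambda>x. f x + g x)"
  using assms(2,3)
proof (induct k arbitrary: f g)
  case 0 then show ?case by (auto intro: continuous_on_add)
next
  case (Suc k)
  show ?case
    by (rule Ck_on_SucI[OF assms(1), where f' = "\<lambda>x v. frechet_derivative f (at x) v
        + frechet_derivative g (at x) v"])
     (use Suc in \<open>auto intro!: has_derivative_add simp: frechet_derivative_works[symmetric]\<close>)
qed

lemma Ck_on_sum:
  assumes "open S" "\<And>b. b \<in> B \<Longrightarrow> Ck_on k S (f b)"
  shows "Ck_on k S (\<lambda>x. \<Sum>b\<in>B. f b x)"
  using assms(2)
  by (induct B rule: infinite_finite_induct) (auto intro: Ck_on_const Ck_on_add assms(1))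

lemma Ck_on_scaleR:
  assumes "open S" "Ck_on k S a" "Ck_on k S f"
  shows "Ck_on k S (\<lambda>x. a x *\<^sub>R f x)"
  using assms(2,3)
proof (induct k arbitrary: a f)
  case 0 then show ?case by (auto intro: continuous_on_scaleR)
next
  case (Suc k)
  show ?case
    by (rule Ck_on_SucI[OF assms(1), where f' = "\<lambda>x v. a x *\<^sub>R frechet_derivative f (at x) v
        + frechet_derivative a (at x) v *\<^sub>R f x"])
     (use Suc Ck_on_Suc_imp[OF Suc(2)] Ck_on_Suc_imp[OF Suc(3)] in
       \<open>auto intro!: has_derivative_scaleR Ck_on_add assms(1) simp: frechet_derivative_works[symmetric]\<close>)
qed

lemma Ck_on_Pair:
  assumes "open S" "Ck_on k S f" "Ck_on k S g"
  shows "Ck_on k S (\<lambda>x. (f x, g x))"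
proof -
  have "Ck_on k S (\<lambda>x. (f x, 0) + (0, g x))"
    by (intro Ck_on_add assms Ck_on_bounded_linear_comp[where L = "\<lambda>y. (y, 0)"]
        Ck_on_bounded_linear_comp[where L = "\<lambda>y. (0, y)"] bounded_linear_Pair bounded_linear_zero
        bounded_linear_ident)
  then show ?thesis by simp
qed

text \<open>Induction on the order: the derivative \<open>Dg(f x)(Df(x) v)\<close> depends on \<open>x\<close> through the point and through
  the vector. Expanding the vector in a frame separates the two, and leaves products of
  coefficients of \<open>Df(x) v\<close> with the composites \<open>Dg(f x) b\<close>, to which the induction hypothesis applies.
  This is where the middle space has to be finite-dimensional.\<close>

lemma Ck_on_compose:
  fixes g :: "'b::real_inner \<Rightarrow> 'c::real_normed_vector" and B :: "'b set"
  assumes "tight_frame B" "open S" "open T" "f ` S \<subseteq> T" "Ck_on k S f" "Ck_on k T g"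
  shows "Ck_on k S (\<lambda>x. g (f x))"
  using assms(5,6)
proof (induct k arbitrary: g)
  case 0
  then show ?case using assms(4) by (auto intro: continuous_on_compose2)
next
  case (Suc k)
  let ?D = "\<lambda>x v. frechet_derivative g (at (f x)) (frechet_derivative f (at x) v)"
  have lin: "linear (frechet_derivative g (at (f x)))" if "x \<in> S" for x
    using that Suc.prems assms(4) by (auto intro!: linear_frechet_derivative)
  show ?case
  proof (rule Ck_on_SucI[OF assms(2), where f' = ?D])
    fix x assume x: "x \<in> S"
    show "((\<lambda>x. g (f x)) has_derivative ?D x) (at x)"
      by (rule has_derivative_compose[of f, OF Ck_on_Suc_has_derivative Ck_on_Suc_has_derivative])
        (use x Suc assms in auto)
  next
    fix v
    have *: "Ck_on k S (\<lambda>x. \<Sum>b\<in>B. (frechet_derivative f (at x) v \<bullet> b)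
        *\<^sub>R frechet_derivative g (at (f x)) b)"
      by (intro Ck_on_sum assms Ck_on_scaleR Ck_on_bounded_linear_comp[where L="\<lambda>y. y \<bullet> b" for b]
          bounded_linear_inner_left Suc.hyps) (use Suc Ck_on_Suc_imp[OF Suc(2)] in auto)
    show "Ck_on k S (\<lambda>x. ?D x v)"
      by (rule Ck_on_cong[OF assms(2) _ *])
        (simp add: tight_frame_linear_expansion[OF assms(1) lin])
  qed
qed

lemma smooth_on_has_derivative:
  assumes "smooth_on S f" "x \<in> S"
  shows "(f has_derivative frechet_derivative f (at x)) (at x)"
  using assms Ck_on_Suc_has_derivative unfolding smooth_on_def by blast

lemma smooth_on_linear_derivative:
  assumes "smooth_on S f" "x \<in> S"
  shows "linear (frechet_derivative f (at x))"
  using smooth_on_has_derivative[OF assms] has_derivative_linear by blast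

lemma smooth_on_derivative: "smooth_on S f \<Longrightarrow> smooth_on S (\<lambda>x. frechet_derivative f (at x) v)"
  unfolding smooth_on_def by (metis Ck_on.simps(2))

lemma smooth_on_continuous: "smooth_on S f \<Longrightarrow> continuous_on S f"
  unfolding smooth_on_def by (metis Ck_on.simps(1))

lemma smooth_on_mono: "smooth_on S f \<Longrightarrow> T \<subseteq> S \<Longrightarrow> smooth_on T f"
  unfolding smooth_on_def using Ck_on_mono by blast

lemma smooth_on_cong:
  "open S \<Longrightarrow> (\<And>x. x \<in> S \<Longrightarrow> f x = g x) \<Longrightarrow> smooth_on S f \<Longrightarrow> smooth_on S g"
  unfolding smooth_on_def using Ck_on_cong by blast

lemma smooth_on_local:
  assumes "\<And>x. x \<in> S \<Longrightarrow> \<exists>T. open T \<and> x \<in> T \<and> smooth_on T f"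
  shows "smooth_on S f"
  unfolding smooth_on_def
proof
  fix k
  show "Ck_on k S f"
    by (rule Ck_on_local) (metis assms smooth_on_def)
qed

lemma smooth_on_const: "open S \<Longrightarrow> smooth_on S (\<lambda>x. c)"
  unfolding smooth_on_def by (blast intro: Ck_on_const)

lemma smooth_on_bounded_linear: "open S \<Longrightarrow> bounded_linear L \<Longrightarrow> smooth_on S L"
  unfolding smooth_on_def by (blast intro: Ck_on_bounded_linear)

lemma smooth_on_Pair:
  "open S \<Longrightarrow> smooth_on S f \<Longrightarrow> smooth_on S g \<Longrightarrow> smooth_on S (\<lambda>x. (f x, g x))"
  unfolding smooth_on_def by (blast intro: Ck_on_Pair)

lemma smooth_on_compose:
  fixes g :: "'b::real_inner \<Rightarrow> 'c::real_normed_vector" and B :: "'b set"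
  assumes "tight_frame B" "open S" "open T" "f ` S \<subseteq> T" "smooth_on S f" "smooth_on T g"
  shows "smooth_on S (\<lambda>x. g (f x))"
  using assms(5,6) unfolding smooth_on_def by (blast intro: Ck_on_compose[OF assms(1-4)])

lemma smooth_on_add:
  "open S \<Longrightarrow> smooth_on S f \<Longrightarrow> smooth_on S g \<Longrightarrow> smooth_on S (\<lambda>x. f x + g x)"
  unfolding smooth_on_def by (blast intro: Ck_on_add)

lemma smooth_on_frame_combination:
  assumes "open S" "\<And>b. b \<in> B \<Longrightarrow> smooth_on S (g b)" "smooth_on S f"
  shows "smooth_on S (\<lambda>x. \<Sum>b\<in>B. (f x \<bullet> b) *\<^sub>R g b x)"
  unfolding smooth_on_def
proof
  fix k
  show "Ck_on k S (\<lambda>x. \<Sum>b\<in>B. (f x \<bullet> b) *\<^sub>R g b x)"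
    by (intro Ck_on_sum assms(1) Ck_on_scaleR Ck_on_bounded_linear_comp[where L="\<lambda>y. y \<bullet> b" for b]
          bounded_linear_inner_left) (use assms in \<open>auto simp: smooth_on_def\<close>)
qed

section \<open>Symmetry of second derivatives\<close>

lemma has_real_derivative_along_line:
  fixes f :: "'a::real_normed_vector \<Rightarrow> real"
  assumes "(f has_derivative D) (at (a + s *\<^sub>R u))"
  shows "((\<lambda>s. f (a + s *\<^sub>R u)) has_real_derivative D u) (at s)"
proof -
  have "((\<lambda>s. a + s *\<^sub>R u) has_derivative (\<lambda>r. r *\<^sub>R u)) (at s)"
    by (auto intro!: derivative_eq_intros)
  then have "((\<lambda>s. f (a + s *\<^sub>R u)) has_derivative (\<lambda>r. D (r *\<^sub>R u))) (at s)"
    using assms by (rule has_derivative_compose)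
  then show ?thesis
    by (rule has_derivative_imp_has_field_derivative)
      (simp add: linear_cmul[OF has_derivative_linear[OF assms]])
qed

text \<open>The mean value theorem, first in the direction \<open>u\<close> and then in the direction \<open>w\<close>.\<close>

lemma second_difference_eq:
  fixes f :: "'a::real_normed_vector \<Rightarrow> real"
  assumes f: "smooth_on S f" and h: "h > 0"
    and S: "\<And>s t. 0 \<le> s \<Longrightarrow> s \<le> h \<Longrightarrow> 0 \<le> t \<Longrightarrow> t \<le> h \<Longrightarrow> x + s *\<^sub>R u + t *\<^sub>R w \<in> S"
  obtains s t where "0 < s" "s < h" "0 < t" "t < h"
    and "f (x + h *\<^sub>R u + h *\<^sub>R w) - f (x + h *\<^sub>R w) - f (x + h *\<^sub>R u) + f x =
      h * h * frechet_derivative (\<lambda>y. frechet_derivative f (at y) u) (at (x + s *\<^sub>R u + t *\<^sub>R w)) w"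
proof -
  let ?D = "\<lambda>y. frechet_derivative f (at y) u"
  let ?\<phi> = "\<lambda>s. f ((x + h *\<^sub>R w) + s *\<^sub>R u) - f (x + s *\<^sub>R u)"
  have "(?\<phi> has_real_derivative ?D (x + h *\<^sub>R w + s *\<^sub>R u) - ?D (x + s *\<^sub>R u)) (at s)"
    if "0 \<le> s" "s \<le> h" for s
    by (intro DERIV_diff has_real_derivative_along_line smooth_on_has_derivative[OF f])
      (use S[OF that, of h] S[OF that, of 0] h in \<open>simp_all add: ac_simps\<close>)
  from MVT2[OF h this] obtain s where s: "0 < s" "s < h"
    and 1: "?\<phi> h - ?\<phi> 0 = h * (?D (x + h *\<^sub>R w + s *\<^sub>R u) - ?D (x + s *\<^sub>R u))"
    by auto
  have "((\<lambda>t. ?D ((x + s *\<^sub>R u) + t *\<^sub>R w)) has_real_derivative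
      frechet_derivative ?D (at (x + s *\<^sub>R u + t *\<^sub>R w)) w) (at t)" if "0 \<le> t" "t \<le> h" for t
    by (intro has_real_derivative_along_line
        smooth_on_has_derivative[OF smooth_on_derivative[OF f]] S) (use s that in auto)
  from MVT2[OF h this] obtain t where t: "0 < t" "t < h"
    and 2: "?D (x + s *\<^sub>R u + h *\<^sub>R w) - ?D (x + s *\<^sub>R u) =
      h * frechet_derivative ?D (at (x + s *\<^sub>R u + t *\<^sub>R w)) w"
    by auto
  have "?\<phi> h - ?\<phi> 0 = h * (h * frechet_derivative ?D (at (x + s *\<^sub>R u + t *\<^sub>R w)) w)"
    unfolding 1 using 2 by (simp add: ac_simps)
  then show ?thesis
    by (intro that[OF s t]) (simp add: ac_simps)
qed

text \<open>The second difference of a small parallelogram is symmetric in its two sides, and divided by \<open>h\<^sup>2\<close> it is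
  a value near \<open>x\<close> of either mixed derivative. Since both mixed derivatives are continuous, they agree at \<open>x\<close>.\<close>

lemma symmetric_second_derivative:
  fixes f :: "'a::real_normed_vector \<Rightarrow> real"
  assumes "open S" "x \<in> S" and f: "smooth_on S f"
  shows "frechet_derivative (\<lambda>y. frechet_derivative f (at y) u) (at x) w =
    frechet_derivative (\<lambda>y. frechet_derivative f (at y) w) (at x) u"
proof (rule ccontr)
  let ?a = "\<lambda>u w y. frechet_derivative (\<lambda>y. frechet_derivative f (at y) u) (at y) w"
  assume ne: "?a u w x \<noteq> ?a w u x"
  define e where "e = \<bar>?a u w x - ?a w u x\<bar> / 2"
  have e: "e > 0" using ne by (simp add: e_def)
  have cont: "\<exists>d>0. \<forall>y. dist y x < d \<longrightarrow> dist (?a u w y) (?a u w x) < e" for u w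
  proof -
    have "continuous (at x) (?a u w)"
      using smooth_on_continuous[OF smooth_on_derivative[OF smooth_on_derivative[OF f]]] assms(1,2)
      by (simp add: continuous_on_eq_continuous_at)
    then show ?thesis using e by (simp add: continuous_at_eps_delta)
  qed
  obtain d1 where d1: "d1 > 0" "\<And>y. dist y x < d1 \<Longrightarrow> dist (?a u w y) (?a u w x) < e"
    using cont by blast
  obtain d2 where d2: "d2 > 0" "\<And>y. dist y x < d2 \<Longrightarrow> dist (?a w u y) (?a w u x) < e"
    using cont by blast
  obtain d3 where d3: "d3 > 0" "\<And>y. dist y x < d3 \<Longrightarrow> y \<in> S"
    using assms(1,2) by (meson open_dist)
  define d where "d = min d1 (min d2 d3)"
  have d: "d > 0" using d1 d2 d3 by (simp add: d_def)
  \<comment> \<open>The \<open>1\<close> keeps the denominator positive when \<open>u = w = 0\<close>.\<close>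
  define h where "h = d / (norm u + norm w + 1)"
  have h: "h > 0" using d by (simp add: h_def add_nonneg_pos)
  have hd: "h * (norm u + norm w) < d"
  proof -
    have "h * (norm u + norm w + 1) = d"
      by (simp add: h_def) (metis add_nonneg_pos less_numeral_extra(1,3) norm_ge_zero add_nonneg_nonneg)
    then show ?thesis using h by (simp add: algebra_simps)
  qed
  have near: "dist (x + s *\<^sub>R u + t *\<^sub>R w) x < d" if "0 \<le> s" "s \<le> h" "0 \<le> t" "t \<le> h" for s t
  proof -
    have "dist (x + s *\<^sub>R u + t *\<^sub>R w) x = norm (s *\<^sub>R u + t *\<^sub>R w)"
      by (simp add: dist_norm)
    also have "\<dots> \<le> s * norm u + t * norm w"
      using that by (intro norm_triangle_le) simp
    also have "\<dots> \<le> h * (norm u + norm w)"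
      using that by (simp add: distrib_left add_mono mult_right_mono)
    finally show ?thesis using hd by simp
  qed
  obtain s t where st: "0 < s" "s < h" "0 < t" "t < h"
    and 1: "f (x + h *\<^sub>R u + h *\<^sub>R w) - f (x + h *\<^sub>R w) - f (x + h *\<^sub>R u) + f x =
      h * h * ?a u w (x + s *\<^sub>R u + t *\<^sub>R w)"
    by (rule second_difference_eq[OF f h, of x u w]) (use near d3 in \<open>auto simp: d_def\<close>)
  have near': "dist (x + s *\<^sub>R w + t *\<^sub>R u) x < d" if "0 \<le> s" "s \<le> h" "0 \<le> t" "t \<le> h" for s t
    using near[of t s] that by (simp add: ac_simps)
  obtain s' t' where st': "0 < s'" "s' < h" "0 < t'" "t' < h"
    and 2: "f (x + h *\<^sub>R w + h *\<^sub>R u) - f (x + h *\<^sub>R u) - f (x + h *\<^sub>R w) + f x =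
      h * h * ?a w u (x + s' *\<^sub>R w + t' *\<^sub>R u)"
    by (rule second_difference_eq[OF f h, of x w u]) (use near' d3 in \<open>auto simp: d_def\<close>)
  have "h * h * ?a u w (x + s *\<^sub>R u + t *\<^sub>R w) = h * h * ?a w u (x + s' *\<^sub>R w + t' *\<^sub>R u)"
    unfolding 1[symmetric] 2[symmetric] by (simp add: ac_simps)
  then have "?a u w (x + s *\<^sub>R u + t *\<^sub>R w) = ?a w u (x + s' *\<^sub>R w + t' *\<^sub>R u)"
    using h by simp
  moreover have "dist (?a u w (x + s *\<^sub>R u + t *\<^sub>R w)) (?a u w x) < e"
    using near[of s t] st by (intro d1) (auto simp: d_def)
  moreover have "dist (?a w u (x + s' *\<^sub>R w + t' *\<^sub>R u)) (?a w u x) < e"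
    using near'[of s' t'] st' by (intro d2) (auto simp: d_def)
  ultimately show False by (simp add: e_def dist_real_def abs_if split: if_splits)
qed

section \<open>Smooth maps between manifolds\<close>

lemma chartD:
  assumes "is_chart (U, \<phi>)"
  shows "open U" "open (\<phi> ` U)" "continuous_on U \<phi>" "continuous_on (\<phi> ` U) (inv_into U \<phi>)"
    and "x \<in> U \<Longrightarrow> inv_into U \<phi> (\<phi> x) = x"
    and "inj_on \<phi> U"
proof -
  have "homeomorphism U (\<phi> ` U) \<phi> (inv_into U \<phi>)" using assms by (simp add: is_chart_def)
  then show "continuous_on U \<phi>" "continuous_on (\<phi> ` U) (inv_into U \<phi>)"
    and inv: "x \<in> U \<Longrightarrow> inv_into U \<phi> (\<phi> x) = x" for x
    by (auto simp: homeomorphism_def)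
  then show "inj_on \<phi> U" by (metis inj_onI)
qed (use assms in \<open>auto simp: is_chart_def\<close>)

lemma chart_open_image:
  assumes "is_chart (U, \<phi>)" "open W" "W \<subseteq> U"
  shows "open (\<phi> ` W)"
proof -
  have "\<phi> ` W = \<phi> ` U \<inter> inv_into U \<phi> -` W"
    using assms(3) chartD(5)[OF assms(1)] by (auto 4 3)
  then show ?thesis
    using continuous_open_preimage[OF chartD(4,2)[OF assms(1)] assms(2)] by simp
qed

lemma manifold_chart: "smooth_manifold A \<Longrightarrow> c \<in> A \<Longrightarrow> is_chart c"
  by (auto simp: smooth_manifold_def)

lemma manifold_chart_at:
  assumes "smooth_manifold A"
  obtains U \<phi> where "(U, \<phi>) \<in> A" "p \<in> U"
proof -
  have "p \<in> \<Union> (fst ` A)" using assms by (simp add: smooth_manifold_def)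
  then show ?thesis using that by auto
qed

lemma manifold_frame:
  fixes A :: "('m::{t2_space, second_countable_topology}, 'e::real_inner) chart set"
  assumes "smooth_manifold A"
  obtains B :: "'e set" where "tight_frame B"
proof -
  obtain S :: "'e set" where "finite S" "span S = UNIV"
    using assms unfolding smooth_manifold_def by (elim conjE exE)
  then show ?thesis using tight_frame_exists that by blast
qed

lemma manifold_transition:
  assumes "smooth_manifold A" "(U, \<phi>) \<in> A" "(V, \<psi>) \<in> A"
  shows "smooth_on (\<phi> ` (U \<inter> V)) (\<lambda>x. \<psi> (inv_into U \<phi> x))"
  using assms unfolding smooth_manifold_def comp_def by blast

lemma smooth_map_onD:
  assumes "smooth_map_on A B W f" "(U, \<phi>) \<in> A" "(V, \<psi>) \<in> B"
  shows "smooth_on (\<phi> ` {x \<in> U \<inter> W. f x \<in> V}) (\<psi> \<circ> f \<circ> inv_into U \<phi>)"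
  using bspec[OF bspec[OF conjunct2[OF conjunct2[OF
          assms(1)[unfolded smooth_map_on_def split_def]]] assms(2)] assms(3)]
  by simp

text \<open>Smoothness near a point is tested in every pair of charts; because transition maps are smooth, a single
  pair around the point and its image suffices. All closure properties of smooth maps are derived from this
  criterion.\<close>

lemma smooth_near_chart_iff:
  fixes A :: "('m::{t2_space, second_countable_topology}, 'e::real_inner) chart set"
    and B :: "('n::{t2_space, second_countable_topology}, 'f::real_inner) chart set"
  assumes A: "smooth_manifold A" and B: "smooth_manifold B"
    and U: "(U, \<phi>) \<in> A" "p \<in> U" and V: "(V, \<psi>) \<in> B" "f p \<in> V"
  shows "smooth_near A B p f \<longleftrightarrow>
    (\<exists>N. open N \<and> \<phi> p \<in> N \<and> N \<subseteq> \<phi> ` U \<and> (\<forall>x\<in>N. f (inv_into U \<phi> x) \<in> V) \<and>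
      smooth_on N (\<lambda>x. \<psi> (f (inv_into U \<phi> x))))"
    (is "?L \<longleftrightarrow> ?R")
proof
  note cU = chartD[OF manifold_chart[OF A U(1)]] and cV = chartD[OF manifold_chart[OF B V(1)]]
  assume ?L
  then obtain W where W': "p \<in> W" "smooth_map_on A B W f"
    unfolding smooth_near_def by (elim exE conjE)
  then have W: "p \<in> W" "open W" "continuous_on W f" by (simp_all add: smooth_map_on_def)
  have "{x \<in> U \<inter> W. f x \<in> V} = (U \<inter> W) \<inter> f -` V" by auto
  also have "open \<dots>"
    by (intro continuous_open_preimage continuous_on_subset[OF W(3)] open_Int W cU cV) auto
  finally have "open (\<phi> ` {x \<in> U \<inter> W. f x \<in> V})"
    using chart_open_image[OF manifold_chart[OF A U(1)]] by blast
  then show ?R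
    using smooth_map_onD[OF W'(2) U(1) V(1)] U V W cU(5) unfolding comp_def
    by (intro exI[of _ "\<phi> ` {x \<in> U \<inter> W. f x \<in> V}"]) auto
next
  note cU = chartD[OF manifold_chart[OF A U(1)]] and cV = chartD[OF manifold_chart[OF B V(1)]]
  assume ?R
  then obtain N where N: "open N" "\<phi> p \<in> N" "N \<subseteq> \<phi> ` U" "\<And>x. x \<in> N \<Longrightarrow> f (inv_into U \<phi> x) \<in> V"
    and sm: "smooth_on N (\<lambda>x. \<psi> (f (inv_into U \<phi> x)))" by blast
  define W where "W = U \<inter> \<phi> -` N"
  have W: "open W" unfolding W_def by (intro continuous_open_preimage cU N)
  have fV: "f x \<in> V" if "x \<in> W" for x
    using N(4)[of "\<phi> x"] that cU(5) by (auto simp: W_def)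
  have "continuous_on W (\<lambda>x. inv_into V \<psi> (\<psi> (f (inv_into U \<phi> (\<phi> x)))))"
    by (intro continuous_on_compose2[OF cV(4)] continuous_on_compose2[OF smooth_on_continuous[OF sm]]
        continuous_on_subset[OF cU(3)]) (use N in \<open>auto simp: W_def\<close>)
  then have cont: "continuous_on W f"
    by (rule continuous_on_eq) (use fV cU(5) cV(5) in \<open>simp add: W_def\<close>)
  obtain FA :: "'e set" where FA: "tight_frame FA" using manifold_frame[OF A] .
  obtain FB :: "'f set" where FB: "tight_frame FB" using manifold_frame[OF B] .
  have "smooth_on (\<phi>' ` {x \<in> U' \<inter> W. f x \<in> V'}) (\<psi>' \<circ> f \<circ> inv_into U' \<phi>')"
    if U': "(U', \<phi>') \<in> A" and V': "(V', \<psi>') \<in> B" for U' \<phi>' V' \<psi>'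
  proof -
    note cU' = chartD[OF manifold_chart[OF A U']] and cV' = chartD[OF manifold_chart[OF B V']]
    define Q where "Q = {x \<in> U' \<inter> W. f x \<in> V'}"
    have "Q = (U' \<inter> W) \<inter> f -` V'" by (auto simp: Q_def)
    also have "open \<dots>"
      by (intro continuous_open_preimage continuous_on_subset[OF cont] open_Int W cU' cV') auto
    finally have Q: "open Q" .
    have QU: "Q \<subseteq> U'" "Q \<subseteq> U" by (auto simp: Q_def W_def)
    have op: "open (\<phi>' ` Q)" "open (\<phi> ` Q)" "open (\<psi> ` (V \<inter> V'))"
      using chart_open_image[OF manifold_chart[OF A U'] Q QU(1)]
        chart_open_image[OF manifold_chart[OF A U(1)] Q QU(2)]
        chart_open_image[OF manifold_chart[OF B V(1)], of "V \<inter> V'"] cV(1) cV'(1)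
      by auto
    have 1: "smooth_on (\<phi>' ` Q) (\<lambda>y. \<phi> (inv_into U' \<phi>' y))"
      by (rule smooth_on_mono[OF manifold_transition[OF A U' U(1)]]) (use QU in auto)
    \<comment> \<open>In the charts \<open>\<phi>'\<close> and \<open>\<psi>'\<close> the map is the given representative between two transition maps.\<close>
    have 2: "smooth_on (\<phi>' ` Q) (\<lambda>y. \<psi> (f (inv_into U \<phi> (\<phi> (inv_into U' \<phi>' y)))))"
      by (rule smooth_on_compose[OF FA op(1,2) _ 1 smooth_on_mono[OF sm]])
        (use QU cU'(5) in \<open>auto simp: Q_def W_def\<close>)
    have "smooth_on (\<phi>' ` Q)
        (\<lambda>y. \<psi>' (inv_into V \<psi> (\<psi> (f (inv_into U \<phi> (\<phi> (inv_into U' \<phi>' y)))))))"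
      by (rule smooth_on_compose[OF FB op(1,3) _ 2 manifold_transition[OF B V(1) V']])
        (use QU cU'(5) cU(5) fV in \<open>auto simp: Q_def\<close>)
    then have "smooth_on (\<phi>' ` Q) (\<psi>' \<circ> f \<circ> inv_into U' \<phi>')"
      by (rule smooth_on_cong[OF op(1), rotated])
        (use QU cU'(5) cU(5) cV(5) fV in \<open>auto simp: Q_def\<close>)
    then show ?thesis by (simp add: Q_def)
  qed
  moreover have "p \<in> W" using U N by (simp add: W_def)
  ultimately show ?L unfolding smooth_near_def smooth_map_on_def using W cont by blast
qed

lemma smooth_map_imp_smooth_near: "smooth_map A B f \<Longrightarrow> smooth_near A B p f"
  unfolding smooth_near_def by blast

lemma smooth_near_isCont: "smooth_near A B p f \<Longrightarrow> isCont f p"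
  unfolding smooth_near_def smooth_map_on_def using continuous_on_eq_continuous_at by blast

lemma smooth_mapI:
  fixes A :: "('m::{t2_space, second_countable_topology}, 'e::real_inner) chart set"
    and B :: "('n::{t2_space, second_countable_topology}, 'f::real_inner) chart set"
  assumes A: "smooth_manifold A" and B: "smooth_manifold B" and f: "\<And>p. smooth_near A B p f"
  shows "smooth_map A B f"
proof -
  have "smooth_on (\<phi> ` {x \<in> U. f x \<in> V}) (\<lambda>x. \<psi> (f (inv_into U \<phi> x)))"
    if U: "(U, \<phi>) \<in> A" and V: "(V, \<psi>) \<in> B" for U \<phi> V \<psi>
  proof (rule smooth_on_local)
    fix y assume "y \<in> \<phi> ` {x \<in> U. f x \<in> V}"
    then obtain p where p: "p \<in> U" "f p \<in> V" "y = \<phi> p" by blast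
    show "\<exists>N. open N \<and> y \<in> N \<and> smooth_on N (\<lambda>x. \<psi> (f (inv_into U \<phi> x)))"
      using f[of p] unfolding smooth_near_chart_iff[where f = f, OF A B U p(1) V p(2)] p(3) by blast
  qed
  moreover have "continuous_on UNIV f"
    using smooth_near_isCont[OF f] by (simp add: continuous_at_imp_continuous_on)
  ultimately show ?thesis
    unfolding smooth_map_on_def split_def comp_def by auto
qed

lemma smooth_near_open:
  assumes "smooth_near A B p f"
  obtains W where "open W" "p \<in> W" "\<And>q. q \<in> W \<Longrightarrow> smooth_near A B q f"
  using assms unfolding smooth_near_def smooth_map_on_def by blast

lemma smooth_near_compose:
  fixes A :: "('m::{t2_space, second_countable_topology}, 'e::real_inner) chart set"
    and B :: "('n::{t2_space, second_countable_topology}, 'f::real_inner) chart set"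
    and C :: "('k::{t2_space, second_countable_topology}, 'g::real_inner) chart set"
  assumes A: "smooth_manifold A" and B: "smooth_manifold B" and C: "smooth_manifold C"
    and f: "smooth_near A B p f" and g: "smooth_near B C (f p) g"
  shows "smooth_near A C p (\<lambda>x. g (f x))"
proof -
  obtain U \<phi> where U: "(U, \<phi>) \<in> A" "p \<in> U" using manifold_chart_at[OF A] .
  obtain V \<psi> where V: "(V, \<psi>) \<in> B" "f p \<in> V" using manifold_chart_at[OF B] .
  obtain W \<omega> where W: "(W, \<omega>) \<in> C" "g (f p) \<in> W" using manifold_chart_at[OF C] .
  note cU = chartD[OF manifold_chart[OF A U(1)]] and cV = chartD[OF manifold_chart[OF B V(1)]]
  obtain FB :: "'f set" where FB: "tight_frame FB" using manifold_frame[OF B] .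
  obtain N where N: "open N" "\<phi> p \<in> N" "N \<subseteq> \<phi> ` U" "\<And>x. x \<in> N \<Longrightarrow> f (inv_into U \<phi> x) \<in> V"
    and sf: "smooth_on N (\<lambda>x. \<psi> (f (inv_into U \<phi> x)))"
    using smooth_near_chart_iff[where f = f, OF A B U V] f by auto
  obtain N' where N': "open N'" "\<psi> (f p) \<in> N'" "N' \<subseteq> \<psi> ` V"
      "\<And>x. x \<in> N' \<Longrightarrow> g (inv_into V \<psi> x) \<in> W"
    and sg: "smooth_on N' (\<lambda>x. \<omega> (g (inv_into V \<psi> x)))"
    using smooth_near_chart_iff[where f = g, OF B C V W] g by auto
  define Q where "Q = N \<inter> (\<lambda>x. \<psi> (f (inv_into U \<phi> x))) -` N'"
  have Q: "open Q"
    unfolding Q_def by (intro continuous_open_preimage smooth_on_continuous sf N N')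
  have "smooth_on Q (\<lambda>x. \<omega> (g (inv_into V \<psi> (\<psi> (f (inv_into U \<phi> x))))))"
    by (rule smooth_on_compose[OF FB Q N'(1) _ smooth_on_mono[OF sf] sg]) (auto simp: Q_def)
  then have "smooth_on Q (\<lambda>x. \<omega> (g (f (inv_into U \<phi> x))))"
    by (rule smooth_on_cong[OF Q, rotated]) (use N(4) cV(5) in \<open>auto simp: Q_def\<close>)
  moreover have "g (f (inv_into U \<phi> x)) \<in> W" if "x \<in> Q" for x
    using N'(4)[of "\<psi> (f (inv_into U \<phi> x))"] N(4)[of x] that cV(5) by (auto simp: Q_def)
  moreover have "\<phi> p \<in> Q" "Q \<subseteq> \<phi> ` U" using N N' U cU(5) by (auto simp: Q_def)
  ultimately show ?thesis
    using smooth_near_chart_iff[of A C U \<phi> p W \<omega> "\<lambda>x. g (f x)", OF A C U W] Q by blast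
qed

lemma inv_into_map_prod:
  assumes "inj_on \<phi> U" "inj_on \<psi> V" "z \<in> (\<phi> ` U) \<times> (\<psi> ` V)"
  shows "inv_into (U \<times> V) (map_prod \<phi> \<psi>) z = (inv_into U \<phi> (fst z), inv_into V \<psi> (snd z))"
  by (rule inv_into_f_eq)
    (use assms in \<open>auto simp: map_prod_inj_on inv_into_into f_inv_into_f\<close>)

lemma map_prod_image: "map_prod f g ` (S \<times> T) = (f ` S) \<times> (g ` T)"
  by auto

lemma prod_atlasI: "(U, \<phi>) \<in> A \<Longrightarrow> (V, \<psi>) \<in> B \<Longrightarrow> (U \<times> V, map_prod \<phi> \<psi>) \<in> prod_atlas A B"
  by (auto simp: prod_atlas_def)

lemma is_chart_prod:
  assumes "is_chart (U, \<phi>)" "is_chart (V, \<psi>)"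
  shows "is_chart (U \<times> V, map_prod \<phi> \<psi>)"
proof -
  note cU = chartD[OF assms(1)] and cV = chartD[OF assms(2)]
  have inv: "inv_into (U \<times> V) (map_prod \<phi> \<psi>) z = (inv_into U \<phi> (fst z), inv_into V \<psi> (snd z))"
    if "z \<in> (\<phi> ` U) \<times> (\<psi> ` V)" for z
    by (rule inv_into_map_prod[OF cU(6) cV(6) that])
  have "continuous_on (U \<times> V) (\<lambda>z. (\<phi> (fst z), \<psi> (snd z)))"
    by (intro continuous_on_Pair continuous_on_compose2[OF cU(3)] continuous_on_compose2[OF cV(3)]
        continuous_on_fst continuous_on_snd continuous_on_id) auto
  then have 1: "continuous_on (U \<times> V) (map_prod \<phi> \<psi>)"
    by (rule continuous_on_eq) auto
  have "continuous_on ((\<phi> ` U) \<times> (\<psi> ` V)) (\<lambda>z. (inv_into U \<phi> (fst z), inv_into V \<psi> (snd z)))"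
    by (intro continuous_on_Pair continuous_on_compose2[OF cU(4)] continuous_on_compose2[OF cV(4)]
        continuous_on_fst continuous_on_snd continuous_on_id) auto
  then have 2: "continuous_on ((\<phi> ` U) \<times> (\<psi> ` V)) (inv_into (U \<times> V) (map_prod \<phi> \<psi>))"
    by (rule continuous_on_eq) (simp add: inv)
  have "homeomorphism (U \<times> V) (map_prod \<phi> \<psi> ` (U \<times> V)) (map_prod \<phi> \<psi>)
      (inv_into (U \<times> V) (map_prod \<phi> \<psi>))"
    by (rule homeomorphismI)
      (use 1 2 inv cU(5) cV(5) in \<open>auto simp: map_prod_image simp del: map_prod_imageI\<close>)
  then show ?thesis
    using cU(1,2) cV(1,2) by (simp add: is_chart_def map_prod_image open_Times)
qed

lemma span_product:
  fixes S :: "'a::real_vector set" and T :: "'b::real_vector set"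
  assumes "span S = UNIV" "span T = UNIV"
  shows "span ((\<lambda>x. (x, 0)) ` S \<union> (\<lambda>y. (0, y)) ` T) = (UNIV :: ('a \<times> 'b) set)"
    (is "span (?S \<union> ?T) = _")
proof -
  have "(x, y) \<in> span (?S \<union> ?T)" for x y
  proof -
    have "linear (\<lambda>x::'a. (x, 0::'b))" "linear (\<lambda>y::'b. (0::'a, y))"
      by (auto intro!: linearI simp: zero_prod_def)
    then have "(x, 0) \<in> span ?S" "(0, y) \<in> span ?T"
      using assms by (auto simp: linear_span_image)
    then have "(x, 0) \<in> span (?S \<union> ?T)" "(0, y) \<in> span (?S \<union> ?T)"
      using span_mono[of ?S "?S \<union> ?T"] span_mono[of ?T "?S \<union> ?T"] by auto
    then have "(x, 0) + (0, y) \<in> span (?S \<union> ?T)" by (rule span_add)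
    then show ?thesis by simp
  qed
  then show ?thesis by auto
qed

lemma smooth_manifold_prod:
  fixes A :: "('m::{t2_space, second_countable_topology}, 'e::real_inner) chart set"
    and B :: "('n::{t2_space, second_countable_topology}, 'f::real_inner) chart set"
  assumes A: "smooth_manifold A" and B: "smooth_manifold B"
  shows "smooth_manifold (prod_atlas A B)"
  unfolding smooth_manifold_def
proof (intro conjI ballI, goal_cases)
  case 1
  obtain S T where "finite S" "finite T" "span S = (UNIV :: 'e set)" "span T = (UNIV :: 'f set)"
    using A B unfolding smooth_manifold_def by (elim conjE exE)
  then show ?case
    by (intro exI[of _ "(\<lambda>x. (x, 0)) ` S \<union> (\<lambda>y. (0, y)) ` T"]) (simp add: span_product)
next
  case (2 c)
  then show ?case
    using manifold_chart[OF A] manifold_chart[OF B]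
    by (auto simp: prod_atlas_def intro!: is_chart_prod)
next
  case 3
  have "\<exists>c\<in>prod_atlas A B. z \<in> fst c" for z
  proof -
    obtain U \<phi> where "(U, \<phi>) \<in> A" "fst z \<in> U" using manifold_chart_at[OF A] .
    moreover obtain V \<psi> where "(V, \<psi>) \<in> B" "snd z \<in> V" using manifold_chart_at[OF B] .
    ultimately show ?thesis
      by (intro bexI[of _ "(U \<times> V, map_prod \<phi> \<psi>)"]) (auto simp: prod_atlas_def mem_Times_iff)
  qed
  then show ?case by auto
next
  case (4 c)
  have "smooth_on (snd c ` (fst c \<inter> fst d)) (snd d \<circ> inv_into (fst c) (snd c))"
    if d: "d \<in> prod_atlas A B" for d
  proof -
    obtain FA :: "'e set" where FA: "tight_frame FA" using manifold_frame[OF A] .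
    obtain FB :: "'f set" where FB: "tight_frame FB" using manifold_frame[OF B] .
    obtain U \<phi> V \<psi> where c: "c = (U \<times> V, map_prod \<phi> \<psi>)" and U: "(U, \<phi>) \<in> A" and V: "(V, \<psi>) \<in> B"
      using 4(1) by (auto simp: prod_atlas_def)
    obtain U' \<phi>' V' \<psi>' where d: "d = (U' \<times> V', map_prod \<phi>' \<psi>')"
      and U': "(U', \<phi>') \<in> A" and V': "(V', \<psi>') \<in> B"
      using d by (auto simp: prod_atlas_def)
    note cU = chartD[OF manifold_chart[OF A U]] and cV = chartD[OF manifold_chart[OF B V]]
    let ?S = "\<phi> ` (U \<inter> U')" and ?T = "\<psi> ` (V \<inter> V')"
    have op: "open ?S" "open ?T"
      using chart_open_image[OF manifold_chart[OF A U], of "U \<inter> U'"] cU(1)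
        chartD(1)[OF manifold_chart[OF A U']] chart_open_image[OF manifold_chart[OF B V], of "V \<inter> V'"]
        cV(1) chartD(1)[OF manifold_chart[OF B V']] by auto
    then have opT: "open (?S \<times> ?T)" by (rule open_Times)
    have "smooth_on (?S \<times> ?T) (\<lambda>z. (\<phi>' (inv_into U \<phi> (fst z)), \<psi>' (inv_into V \<psi> (snd z))))"
      by (intro smooth_on_Pair opT smooth_on_bounded_linear bounded_linear_fst bounded_linear_snd
          smooth_on_compose[OF FA opT op(1) _ _ manifold_transition[OF A U U']]
          smooth_on_compose[OF FB opT op(2) _ _ manifold_transition[OF B V V']]) auto
    then have "smooth_on (?S \<times> ?T) (map_prod \<phi>' \<psi>' \<circ> inv_into (U \<times> V) (map_prod \<phi> \<psi>))"
      by (rule smooth_on_cong[OF opT, rotated])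
        (subst comp_apply, subst inv_into_map_prod[OF cU(6) cV(6)], auto)
    then show ?thesis
      by (simp add: c d Times_Int_Times map_prod_image)
  qed
  then show ?case by (simp add: split_def)
qed

lemma inv_into_UNIV_ident: "inv_into UNIV (\<lambda>x. x) = (\<lambda>x. x)"
  using inv_id unfolding id_def .

lemma smooth_manifold_real: "smooth_manifold real_atlas"
proof -
  have "is_chart (UNIV, \<lambda>x::real. x)"
    by (simp add: is_chart_def inv_into_UNIV_ident homeomorphism_def)
  moreover have "span {1} = (UNIV :: real set)"
    by (auto simp: span_singleton)
  then have "\<exists>B::real set. finite B \<and> span B = UNIV" by (intro exI[of _ "{1}"]) simp
  moreover have "smooth_on UNIV (\<lambda>x::real. x)"
    by (intro smooth_on_bounded_linear bounded_linear_ident open_UNIV)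
  ultimately show ?thesis
    by (simp add: smooth_manifold_def real_atlas_def inv_into_UNIV_ident comp_def)
qed

lemma smooth_near_Pair:
  fixes A :: "('m::{t2_space, second_countable_topology}, 'e::real_inner) chart set"
    and B :: "('n::{t2_space, second_countable_topology}, 'f::real_inner) chart set"
    and C :: "('k::{t2_space, second_countable_topology}, 'g::real_inner) chart set"
  assumes A: "smooth_manifold A" and B: "smooth_manifold B" and C: "smooth_manifold C"
    and f: "smooth_near A B p f" and g: "smooth_near A C p g"
  shows "smooth_near A (prod_atlas B C) p (\<lambda>x. (f x, g x))"
proof -
  obtain U \<phi> where U: "(U, \<phi>) \<in> A" "p \<in> U" using manifold_chart_at[OF A] .
  obtain V \<psi> where V: "(V, \<psi>) \<in> B" "f p \<in> V" using manifold_chart_at[OF B] .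
  obtain W \<omega> where W: "(W, \<omega>) \<in> C" "g p \<in> W" using manifold_chart_at[OF C] .
  obtain N where N: "open N" "\<phi> p \<in> N" "N \<subseteq> \<phi> ` U" "\<And>x. x \<in> N \<Longrightarrow> f (inv_into U \<phi> x) \<in> V"
    and sf: "smooth_on N (\<lambda>x. \<psi> (f (inv_into U \<phi> x)))"
    using smooth_near_chart_iff[where f = f, OF A B U V] f by auto
  obtain N' where N': "open N'" "\<phi> p \<in> N'" "\<And>x. x \<in> N' \<Longrightarrow> g (inv_into U \<phi> x) \<in> W"
    and sg: "smooth_on N' (\<lambda>x. \<omega> (g (inv_into U \<phi> x)))"
    using smooth_near_chart_iff[where f = g, OF A C U W] g by auto
  have op: "open (N \<inter> N')" using N N' by auto
  have "smooth_on (N \<inter> N') (\<lambda>x. (\<psi> (f (inv_into U \<phi> x)), \<omega> (g (inv_into U \<phi> x))))"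
    by (intro smooth_on_Pair op smooth_on_mono[OF sf] smooth_on_mono[OF sg]) auto
  moreover have VW: "(f p, g p) \<in> V \<times> W" using V W by simp
  ultimately show ?thesis
    unfolding smooth_near_chart_iff[of A "prod_atlas B C" U \<phi> p "V \<times> W" "map_prod \<psi> \<omega>"
        "\<lambda>x. (f x, g x)", OF A smooth_manifold_prod[OF B C] U prod_atlasI[OF V(1) W(1)] VW]
    using N N' op by (intro exI[of _ "N \<inter> N'"]) auto
qed

lemma smooth_near_fst_snd:
  fixes A :: "('m::{t2_space, second_countable_topology}, 'e::real_inner) chart set"
    and B :: "('n::{t2_space, second_countable_topology}, 'f::real_inner) chart set"
  assumes A: "smooth_manifold A" and B: "smooth_manifold B"
  shows "smooth_near (prod_atlas A B) A p fst" "smooth_near (prod_atlas A B) B p snd"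
proof -
  obtain U \<phi> where U: "(U, \<phi>) \<in> A" "fst p \<in> U" using manifold_chart_at[OF A] .
  obtain V \<psi> where V: "(V, \<psi>) \<in> B" "snd p \<in> V" using manifold_chart_at[OF B] .
  note cU = chartD[OF manifold_chart[OF A U(1)]] and cV = chartD[OF manifold_chart[OF B V(1)]]
  let ?N = "(\<phi> ` U) \<times> (\<psi> ` V)"
  have p: "p \<in> U \<times> V" using U V by (simp add: mem_Times_iff)
  have op: "open ?N" using cU cV by (simp add: open_Times)
  have inv: "inv_into (U \<times> V) (map_prod \<phi> \<psi>) z = (inv_into U \<phi> (fst z), inv_into V \<psi> (snd z))"
    if "z \<in> ?N" for z by (rule inv_into_map_prod[OF cU(6) cV(6) that])
  have pN: "map_prod \<phi> \<psi> p \<in> ?N" using p by (cases p) auto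
  have 1: "smooth_on ?N (\<lambda>z. \<phi> (fst (inv_into (U \<times> V) (map_prod \<phi> \<psi>) z)))"
    by (rule smooth_on_cong[OF op _ smooth_on_bounded_linear[OF op bounded_linear_fst]])
      (simp only: inv, auto simp: f_inv_into_f)
  have 2: "smooth_on ?N (\<lambda>z. \<psi> (snd (inv_into (U \<times> V) (map_prod \<phi> \<psi>) z)))"
    by (rule smooth_on_cong[OF op _ smooth_on_bounded_linear[OF op bounded_linear_snd]])
      (simp only: inv, auto simp: f_inv_into_f)
  show "smooth_near (prod_atlas A B) A p fst"
    unfolding smooth_near_chart_iff[where f = fst, OF smooth_manifold_prod[OF A B] A prod_atlasI[OF U(1) V(1)] p U]
    using op pN 1 by (intro exI[of _ ?N]) (auto simp: inv map_prod_image inv_into_into)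
  show "smooth_near (prod_atlas A B) B p snd"
    unfolding smooth_near_chart_iff[where f = snd, OF smooth_manifold_prod[OF A B] B prod_atlasI[OF U(1) V(1)] p V]
    using op pN 2 by (intro exI[of _ ?N]) (auto simp: inv map_prod_image inv_into_into)
qed

lemma smooth_near_ident:
  fixes A :: "('m::{t2_space, second_countable_topology}, 'e::real_inner) chart set"
  assumes A: "smooth_manifold A"
  shows "smooth_near A A p (\<lambda>x. x)"
proof -
  obtain U \<phi> where U: "(U, \<phi>) \<in> A" "p \<in> U" using manifold_chart_at[OF A] .
  note cU = chartD[OF manifold_chart[OF A U(1)]]
  have "smooth_on (\<phi> ` U) (\<lambda>x. \<phi> (inv_into U \<phi> x))"
    using manifold_transition[OF A U(1) U(1)] by simp
  then show ?thesis
    unfolding smooth_near_chart_iff[of A A U \<phi> p U \<phi> "\<lambda>x. x", OF A A U U]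
    using U cU by (intro exI[of _ "\<phi> ` U"]) (auto simp: inv_into_into)
qed

lemma smooth_near_const:
  fixes A :: "('m::{t2_space, second_countable_topology}, 'e::real_inner) chart set"
    and B :: "('n::{t2_space, second_countable_topology}, 'f::real_inner) chart set"
  assumes A: "smooth_manifold A" and B: "smooth_manifold B"
  shows "smooth_near A B p (\<lambda>x. c)"
proof -
  obtain U \<phi> where U: "(U, \<phi>) \<in> A" "p \<in> U" using manifold_chart_at[OF A] .
  obtain V \<psi> where V: "(V, \<psi>) \<in> B" "c \<in> V" using manifold_chart_at[OF B] .
  note cU = chartD[OF manifold_chart[OF A U(1)]]
  show ?thesis
    unfolding smooth_near_chart_iff[of A B U \<phi> p V \<psi> "\<lambda>x. c", OF A B U V]
    using U V cU by (intro exI[of _ "\<phi> ` U"]) (auto intro: smooth_on_const)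
qed

lemma smooth_near_cong:
  fixes A :: "('m::{t2_space, second_countable_topology}, 'e::real_inner) chart set"
    and B :: "('n::{t2_space, second_countable_topology}, 'f::real_inner) chart set"
  assumes A: "smooth_manifold A" and B: "smooth_manifold B"
    and W: "open W" "p \<in> W" "\<And>x. x \<in> W \<Longrightarrow> f x = g x" and f: "smooth_near A B p f"
  shows "smooth_near A B p g"
proof -
  obtain U \<phi> where U: "(U, \<phi>) \<in> A" "p \<in> U" using manifold_chart_at[OF A] .
  obtain V \<psi> where V: "(V, \<psi>) \<in> B" "f p \<in> V" using manifold_chart_at[OF B] .
  note cU = chartD[OF manifold_chart[OF A U(1)]]
  obtain N where N: "open N" "\<phi> p \<in> N" "N \<subseteq> \<phi> ` U" "\<And>x. x \<in> N \<Longrightarrow> f (inv_into U \<phi> x) \<in> V"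
    and sf: "smooth_on N (\<lambda>x. \<psi> (f (inv_into U \<phi> x)))"
    using smooth_near_chart_iff[where f = f, OF A B U V] f by auto
  have V': "g p \<in> V" using V W by simp
  define Q where "Q = N \<inter> inv_into U \<phi> -` W"
  have Q: "open Q"
    unfolding Q_def by (intro continuous_open_preimage continuous_on_subset[OF cU(4)] N W)
  have "smooth_on Q (\<lambda>x. \<psi> (g (inv_into U \<phi> x)))"
    by (rule smooth_on_cong[OF Q _ smooth_on_mono[OF sf]]) (use W in \<open>auto simp: Q_def\<close>)
  moreover have "g (inv_into U \<phi> x) \<in> V" if "x \<in> Q" for x
    using N(4)[of x] W(3)[of "inv_into U \<phi> x"] that by (auto simp: Q_def)
  moreover have "\<phi> p \<in> Q" "Q \<subseteq> \<phi> ` U" using N U W cU(5) by (auto simp: Q_def)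
  ultimately show ?thesis
    unfolding smooth_near_chart_iff[of A B U \<phi> p V \<psi> g, OF A B U V(1) V'] using Q by blast
qed

lemma smooth_near_compose2:
  fixes A :: "('m::{t2_space, second_countable_topology}, 'e::real_inner) chart set"
    and B :: "('n::{t2_space, second_countable_topology}, 'f::real_inner) chart set"
    and C :: "('k::{t2_space, second_countable_topology}, 'g::real_inner) chart set"
    and X :: "('x::{t2_space, second_countable_topology}, 'y::real_inner) chart set"
  assumes X: "smooth_manifold X" and A: "smooth_manifold A" and B: "smooth_manifold B"
    and C: "smooth_manifold C"
    and op: "smooth_map (prod_atlas A B) C (\<lambda>(x, y). op x y)"
    and f: "smooth_near X A p f" and g: "smooth_near X B p g"
  shows "smooth_near X C p (\<lambda>x. op (f x) (g x))"
  using smooth_near_compose[OF X smooth_manifold_prod[OF A B] C smooth_near_Pair[OF X A B f g]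
      smooth_map_imp_smooth_near[OF op]]
  by simp

lemma smooth_near_real_iff:
  fixes A :: "('m::{t2_space, second_countable_topology}, 'e::real_inner) chart set"
  assumes A: "smooth_manifold A" and U: "(U, \<phi>) \<in> A" "p \<in> U"
  shows "smooth_near A real_atlas p f \<longleftrightarrow>
    (\<exists>N. open N \<and> \<phi> p \<in> N \<and> N \<subseteq> \<phi> ` U \<and> smooth_on N (\<lambda>x. f (inv_into U \<phi> x)))"
  by (subst smooth_near_chart_iff[of A real_atlas U \<phi> p UNIV "\<lambda>x. x" f, OF A smooth_manifold_real U])
    (auto simp: real_atlas_def)

lemma smooth_near_curve_iff:
  fixes A :: "('m::{t2_space, second_countable_topology}, 'e::real_inner) chart set"
  assumes A: "smooth_manifold A" and U: "(U, \<phi>) \<in> A" "c t \<in> U"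
  shows "smooth_near real_atlas A t c \<longleftrightarrow>
    (\<exists>N. open N \<and> t \<in> N \<and> (\<forall>s\<in>N. c s \<in> U) \<and> smooth_on N (\<lambda>s. \<phi> (c s)))"
  by (subst smooth_near_chart_iff[of real_atlas A UNIV "\<lambda>x. x" t U \<phi> c, OF smooth_manifold_real A _ _ U])
    (auto simp: real_atlas_def inv_into_UNIV_ident)

section \<open>Tangent vectors\<close>

text \<open>The directional derivative \<open>\<Sum>\<^sub>i w\<^sub>i \<partial>\<^sub>i\<close> of the chart, extended by \<open>0\<close> like the velocity of a curve. It
  exhibits the tangent space as a linear image of the model space.\<close>

definition chart_vector ::
    "('m::topological_space, 'e::real_inner) chart set \<Rightarrow> 'm set \<Rightarrow> ('m \<Rightarrow> 'e) \<Rightarrow> 'm \<Rightarrow> 'e \<Rightarrow> 'm tvec"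
  where "chart_vector A U \<phi> p w = (\<lambda>f. if smooth_near A real_atlas p f
    then frechet_derivative (\<lambda>x. f (inv_into U \<phi> x)) (at (\<phi> p)) w else 0)"

lemma smooth_near_real_has_derivative:
  fixes A :: "('m::{t2_space, second_countable_topology}, 'e::real_inner) chart set"
  assumes A: "smooth_manifold A" and U: "(U, \<phi>) \<in> A" "p \<in> U"
    and f: "smooth_near A real_atlas p f"
  shows "((\<lambda>x. f (inv_into U \<phi> x)) has_derivative
    frechet_derivative (\<lambda>x. f (inv_into U \<phi> x)) (at (\<phi> p))) (at (\<phi> p))"
  using smooth_near_real_iff[OF A U] f smooth_on_has_derivative by blast

lemma linear_chart_vector:
  fixes A :: "('m::{t2_space, second_countable_topology}, 'e::real_inner) chart set"
  assumes A: "smooth_manifold A" and U: "(U, \<phi>) \<in> A" "p \<in> U"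
  shows "linear (chart_vector A U \<phi> p)"
  using has_derivative_linear[OF smooth_near_real_has_derivative[OF A U]]
  by (intro linearI ext) (simp_all add: chart_vector_def plus_fun_def scaleR_fun_def linear_add linear_cmul)

lemma velocity_eq_chart_vector:
  fixes A :: "('m::{t2_space, second_countable_topology}, 'e::real_inner) chart set"
  assumes A: "smooth_manifold A" and U: "(U, \<phi>) \<in> A" "c 0 \<in> U"
    and c: "smooth_near real_atlas A 0 c"
  shows "velocity A c = chart_vector A U \<phi> (c 0) (frechet_derivative (\<lambda>s. \<phi> (c s)) (at 0) 1)"
proof
  fix f :: "'m \<Rightarrow> real"
  note cU = chartD[OF manifold_chart[OF A U(1)]]
  let ?D = "frechet_derivative (\<lambda>s. \<phi> (c s)) (at 0)"
  let ?F = "frechet_derivative (\<lambda>x. f (inv_into U \<phi> x)) (at (\<phi> (c 0)))"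
  obtain N where N: "open N" "0 \<in> N" "\<And>s. s \<in> N \<Longrightarrow> c s \<in> U"
    and sm: "smooth_on N (\<lambda>s. \<phi> (c s))"
    using smooth_near_curve_iff[where c = c and t = 0, OF A U] c by auto
  have "deriv (\<lambda>s. f (c s)) 0 = ?F (?D 1)" if f: "smooth_near A real_atlas (c 0) f"
  proof -
    have F: "((\<lambda>x. f (inv_into U \<phi> x)) has_derivative ?F) (at (\<phi> (c 0)))"
      by (rule smooth_near_real_has_derivative[OF A U f])
    have D: "((\<lambda>s. \<phi> (c s)) has_derivative ?D) (at 0)"
      by (rule smooth_on_has_derivative[OF sm N(2)])
    have "((\<lambda>s. f (inv_into U \<phi> (\<phi> (c s)))) has_derivative (\<lambda>r. ?F (?D r))) (at 0)"
      by (rule has_derivative_compose[OF D F])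
    then have "((\<lambda>s. f (c s)) has_derivative (\<lambda>r. ?F (?D r))) (at 0)"
      by (rule has_derivative_transform_within_open[OF _ N(1,2)]) (simp add: N(3) cU(5))
    then have "((\<lambda>s. f (c s)) has_real_derivative ?F (?D 1)) (at 0)"
    proof (rule has_derivative_imp_has_field_derivative)
      fix r
      show "r * ?F (?D 1) = ?F (?D r)"
        using linear_cmul[OF has_derivative_linear[OF D], of r 1]
          linear_cmul[OF has_derivative_linear[OF F], of r "?D 1"] by simp
    qed
    then show ?thesis by (rule DERIV_imp_deriv)
  qed
  then show "velocity A c f = chart_vector A U \<phi> (c 0) (?D 1) f"
    by (simp add: velocity_def chart_vector_def)
qed

text \<open>A vector \<open>w\<close> of the model space is the velocity of the curve that is the line \<open>\<phi> p + s w\<close> in the chart.\<close>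

lemma tangent_space_eq_range:
  fixes A :: "('m::{t2_space, second_countable_topology}, 'e::real_inner) chart set"
  assumes A: "smooth_manifold A" and U: "(U, \<phi>) \<in> A" "p \<in> U"
  shows "tangent_space A p = range (chart_vector A U \<phi> p)"
proof
  show "tangent_space A p \<subseteq> range (chart_vector A U \<phi> p)"
    using velocity_eq_chart_vector[OF A U(1)] U(2) by (auto simp: tangent_space_def)
next
  note cU = chartD[OF manifold_chart[OF A U(1)]]
  show "range (chart_vector A U \<phi> p) \<subseteq> tangent_space A p"
  proof safe
    fix w
    define c where "c = (\<lambda>s. inv_into U \<phi> (\<phi> p + s *\<^sub>R w))"
    have c0: "c 0 = p" using cU(5) U by (simp add: c_def)
    define N where "N = (\<lambda>s. \<phi> p + s *\<^sub>R w) -` (\<phi> ` U)"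
    have N: "open N"
      unfolding N_def by (intro open_vimage cU(2) continuous_intros)
    have N0: "0 \<in> N" using U by (simp add: N_def)
    have eq: "\<phi> (c s) = \<phi> p + s *\<^sub>R w" and cs: "c s \<in> U" if "s \<in> N" for s
      using that by (auto simp: c_def N_def f_inv_into_f inv_into_into)
    have "smooth_on N (\<lambda>s. \<phi> p + s *\<^sub>R w)"
      by (intro smooth_on_add smooth_on_const N smooth_on_bounded_linear bounded_linear_scaleR_left)
    then have sm: "smooth_on N (\<lambda>s. \<phi> (c s))"
      by (rule smooth_on_cong[OF N, rotated]) (simp add: eq)
    then have smc: "smooth_near real_atlas A 0 c"
      using smooth_near_curve_iff[OF A U(1), of c 0] c0 U N N0 cs by auto
    have "((\<lambda>s. \<phi> p + s *\<^sub>R w) has_derivative (\<lambda>r. r *\<^sub>R w)) (at 0)"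
      by (auto intro!: derivative_eq_intros)
    then have "((\<lambda>s. \<phi> (c s)) has_derivative (\<lambda>r. r *\<^sub>R w)) (at 0)"
      by (rule has_derivative_transform_within_open[OF _ N N0]) (simp add: eq)
    then have "frechet_derivative (\<lambda>s. \<phi> (c s)) (at 0) = (\<lambda>r. r *\<^sub>R w)"
      using frechet_derivative_at by metis
    then have "velocity A c = chart_vector A U \<phi> p w"
      using velocity_eq_chart_vector[OF A U(1) _ smc] c0 U by simp
    then show "chart_vector A U \<phi> p w \<in> tangent_space A p"
      unfolding tangent_space_def using c0 smc by force
  qed
qed

lemma subspace_tangent_space:
  fixes A :: "('m::{t2_space, second_countable_topology}, 'e::real_inner) chart set"
  assumes A: "smooth_manifold A"
  shows "subspace (tangent_space A p)"
proof -
  obtain U \<phi> where U: "(U, \<phi>) \<in> A" "p \<in> U" using manifold_chart_at[OF A] .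
  show ?thesis
    unfolding tangent_space_eq_range[OF A U]
    by (rule linear_subspace_image[OF linear_chart_vector[OF A U] subspace_UNIV])
qed

text \<open>Both the smoothness test and the derivative inside a velocity see only the germ of the function. Left
  invariant fields are computed only near the unit, so this is what allows their values elsewhere to be
  arbitrary.\<close>

lemma tangent_vector_local:
  fixes A :: "('m::{t2_space, second_countable_topology}, 'e::real_inner) chart set"
  assumes A: "smooth_manifold A" and \<xi>: "\<xi> \<in> tangent_space A p"
    and W: "open W" "p \<in> W" "\<And>x. x \<in> W \<Longrightarrow> f x = g x"
  shows "\<xi> f = \<xi> g"
proof -
  obtain c where c: "\<xi> = velocity A c" "c 0 = p" "smooth_near real_atlas A 0 c"
    using \<xi> unfolding tangent_space_def by blast
  have "smooth_near A real_atlas p f \<longleftrightarrow> smooth_near A real_atlas p g"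
    using smooth_near_cong[OF A smooth_manifold_real W(1,2), of g f]
      smooth_near_cong[OF A smooth_manifold_real W(1,2), of f g] W(3) by auto
  moreover have "eventually (\<lambda>s. c s \<in> W) (nhds 0)"
    using smooth_near_isCont[OF c(3)] W c(2) unfolding continuous_at tendsto_at_iff_tendsto_nhds
    by (auto dest: topological_tendstoD)
  then have "deriv (\<lambda>s. f (c s)) 0 = deriv (\<lambda>s. g (c s)) 0"
    by (intro deriv_cong_ev) (auto elim!: eventually_mono simp: W(3))
  ultimately show ?thesis unfolding c(1) by (simp add: velocity_def c(2))
qed

lemma tangent_vector_not_smooth:
  "\<xi> \<in> tangent_space A p \<Longrightarrow> \<not> smooth_near A real_atlas p f \<Longrightarrow> \<xi> f = 0"
  by (auto simp: tangent_space_def velocity_def)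

lemma tangent_vector_const:
  "\<xi> \<in> tangent_space A p \<Longrightarrow> \<xi> (\<lambda>x. a) = 0"
  by (auto simp: tangent_space_def velocity_def)

lemma linear_pushforward: "linear (pushforward B \<Phi> p)"
  by (intro linearI ext) (simp_all add: pushforward_def plus_fun_def scaleR_fun_def)

lemma pushforward_tangent:
  fixes A :: "('m::{t2_space, second_countable_topology}, 'e::real_inner) chart set"
    and B :: "('n::{t2_space, second_countable_topology}, 'f::real_inner) chart set"
  assumes A: "smooth_manifold A" and B: "smooth_manifold B"
    and \<Phi>: "smooth_near A B p \<Phi>" and \<xi>: "\<xi> \<in> tangent_space A p"
  shows "pushforward B \<Phi> p \<xi> \<in> tangent_space B (\<Phi> p)"
proof -
  obtain c where c: "\<xi> = velocity A c" "c 0 = p" "smooth_near real_atlas A 0 c"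
    using \<xi> unfolding tangent_space_def by blast
  have "smooth_near A real_atlas p (\<lambda>x. f (\<Phi> x))" if "smooth_near B real_atlas (\<Phi> p) f" for f
    by (rule smooth_near_compose[OF A B smooth_manifold_real \<Phi> that])
  then have "pushforward B \<Phi> p \<xi> = velocity B (\<lambda>s. \<Phi> (c s))"
    by (intro ext) (simp add: pushforward_def velocity_def c comp_def)
  moreover have "smooth_near real_atlas B 0 (\<lambda>s. \<Phi> (c s))"
    by (rule smooth_near_compose[OF smooth_manifold_real A B c(3)]) (simp add: c(2) \<Phi>)
  ultimately show ?thesis unfolding tangent_space_def using c(2) by blast
qed

section \<open>Commutators of vector fields\<close>

lemma smooth_on_derivative_along_field:
  fixes f :: "'e::real_inner \<Rightarrow> real" and Z :: "'e \<Rightarrow> 'e" and B :: "'e set"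
  assumes B: "tight_frame B" and N: "open N" and f: "smooth_on N f" and Z: "smooth_on N Z"
  shows "smooth_on N (\<lambda>x. frechet_derivative f (at x) (Z x))"
proof -
  have "smooth_on N (\<lambda>x. \<Sum>b\<in>B. (Z x \<bullet> b) *\<^sub>R frechet_derivative f (at x) b)"
    by (intro smooth_on_frame_combination N smooth_on_derivative f Z)
  then show ?thesis
    by (rule smooth_on_cong[OF N, rotated])
      (rule tight_frame_linear_expansion[OF B smooth_on_linear_derivative[OF f], symmetric])
qed

text \<open>The product rule for \<open>D(Df(y)(Z y))\<close>, with \<open>Z\<close> expanded in a frame. The second derivative of \<open>f\<close> appears
  with its arguments exchanged: in this form it is the derivative of a fixed function, hence visibly linear
  in \<open>Z x\<close>, so the frame can be summed up again.\<close>

lemma derivative_of_derivative_along_field: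
  fixes f :: "'e::real_inner \<Rightarrow> real" and Z :: "'e \<Rightarrow> 'e" and B :: "'e set"
  assumes B: "tight_frame B" and N: "open N" and x: "x \<in> N"
    and f: "smooth_on N f" and Z: "smooth_on N Z"
  shows "frechet_derivative (\<lambda>y. frechet_derivative f (at y) (Z y)) (at x) u =
    frechet_derivative f (at x) (frechet_derivative Z (at x) u) +
    frechet_derivative (\<lambda>y. frechet_derivative f (at y) u) (at x) (Z x)"
proof -
  let ?D = "\<lambda>b. frechet_derivative (\<lambda>y. frechet_derivative f (at y) b) (at x)"
  have expand: "(\<Sum>b\<in>B. (w \<bullet> b) * frechet_derivative f (at y) b) = frechet_derivative f (at y) w"
    if "y \<in> N" for y w
    using tight_frame_linear_expansion[OF B smooth_on_linear_derivative[OF f that], of w] by simp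
  have "((\<lambda>y. \<Sum>b\<in>B. (Z y \<bullet> b) * frechet_derivative f (at y) b) has_derivative
      (\<lambda>u. \<Sum>b\<in>B. (Z x \<bullet> b) * ?D b u + (frechet_derivative Z (at x) u \<bullet> b)
        * frechet_derivative f (at x) b)) (at x)"
    by (rule has_derivative_sum, rule has_derivative_mult[OF has_derivative_inner_left[OF
            smooth_on_has_derivative[OF Z x]]
          smooth_on_has_derivative[OF smooth_on_derivative[OF f] x]])
  then have "((\<lambda>y. frechet_derivative f (at y) (Z y)) has_derivative
      (\<lambda>u. \<Sum>b\<in>B. (Z x \<bullet> b) * ?D b u + (frechet_derivative Z (at x) u \<bullet> b)
        * frechet_derivative f (at x) b)) (at x)"
    by (rule has_derivative_transform_within_open[OF _ N x])
      (rule expand)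
  then have "frechet_derivative (\<lambda>y. frechet_derivative f (at y) (Z y)) (at x) =
      (\<lambda>u. \<Sum>b\<in>B. (Z x \<bullet> b) * ?D b u + (frechet_derivative Z (at x) u \<bullet> b)
        * frechet_derivative f (at x) b)"
    by (rule frechet_derivative_at[symmetric])
  then have "frechet_derivative (\<lambda>y. frechet_derivative f (at y) (Z y)) (at x) u =
      (\<Sum>b\<in>B. (Z x \<bullet> b) * ?D b u) +
      (\<Sum>b\<in>B. (frechet_derivative Z (at x) u \<bullet> b) * frechet_derivative f (at x) b)"
    by (simp add: sum.distrib)
  also have "(\<Sum>b\<in>B. (Z x \<bullet> b) * ?D b u) = (\<Sum>b\<in>B. (Z x \<bullet> b) *\<^sub>R ?D u b)"
    by (simp add: symmetric_second_derivative[OF N x f, of u])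
  also have "\<dots> = ?D u (Z x)"
    by (rule tight_frame_linear_expansion[OF B
          smooth_on_linear_derivative[OF smooth_on_derivative[OF f] x], symmetric])
  also have "(\<Sum>b\<in>B. (frechet_derivative Z (at x) u \<bullet> b) * frechet_derivative f (at x) b) =
      frechet_derivative f (at x) (frechet_derivative Z (at x) u)"
    by (rule expand[OF x])
  finally show ?thesis by simp
qed

text \<open>The second-order terms are \<open>D\<^sup>2f(Y, Z)\<close> and \<open>D\<^sup>2f(Z, Y)\<close>; they cancel, so the commutator of the fields is again
  a first-order operator.\<close>

lemma commutator_of_derivatives_along_fields:
  fixes f :: "'e::real_inner \<Rightarrow> real" and Y Z :: "'e \<Rightarrow> 'e" and B :: "'e set"
  assumes B: "tight_frame B" and N: "open N" and x: "x \<in> N"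
    and f: "smooth_on N f" and Y: "smooth_on N Y" and Z: "smooth_on N Z"
  shows "frechet_derivative (\<lambda>y. frechet_derivative f (at y) (Z y)) (at x) (Y x) -
      frechet_derivative (\<lambda>y. frechet_derivative f (at y) (Y y)) (at x) (Z x) =
    frechet_derivative f (at x)
      (frechet_derivative Z (at x) (Y x) - frechet_derivative Y (at x) (Z x))"
  unfolding derivative_of_derivative_along_field[OF B N x f Z]
    derivative_of_derivative_along_field[OF B N x f Y]
    symmetric_second_derivative[OF N x f, of "Y x" "Z x"]
  by (simp add: linear_diff[OF smooth_on_linear_derivative[OF f x]])

lemma linear_frechet_derivative_parameter:
  fixes Z :: "'p::real_vector \<Rightarrow> 'a::real_normed_vector \<Rightarrow> 'b::real_normed_vector"
  assumes N: "open N" "x \<in> N" and lin: "\<And>y. y \<in> N \<Longrightarrow> linear (\<lambda>z. Z z y)"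
    and diff: "\<And>z. (Z z has_derivative frechet_derivative (Z z) (at x)) (at x)"
  shows "linear (\<lambda>z. frechet_derivative (Z z) (at x) u)"
proof (rule linearI)
  fix z w
  have "(Z (z + w) has_derivative
      (\<lambda>u. frechet_derivative (Z z) (at x) u + frechet_derivative (Z w) (at x) u)) (at x)"
    by (rule has_derivative_transform_within_open[OF has_derivative_add[OF diff diff] N])
      (simp add: linear_add[OF lin])
  then show "frechet_derivative (Z (z + w)) (at x) u =
      frechet_derivative (Z z) (at x) u + frechet_derivative (Z w) (at x) u"
    by (rule fun_cong[OF frechet_derivative_at[symmetric]])
next
  fix r z
  have "(Z (r *\<^sub>R z) has_derivative (\<lambda>u. r *\<^sub>R frechet_derivative (Z z) (at x) u)) (at x)"
    by (rule has_derivative_transform_within_open[OF has_derivative_scaleR_right[OF diff] N])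
      (simp add: linear_cmul[OF lin])
  then show "frechet_derivative (Z (r *\<^sub>R z)) (at x) u = r *\<^sub>R frechet_derivative (Z z) (at x) u"
    by (rule fun_cong[OF frechet_derivative_at[symmetric]])
qed

section \<open>The bracket of left invariant fields\<close>

text \<open>What the bracket of left invariant fields requires of the multiplication at the unit: the left unit law
  makes the field of \<open>\<xi>\<close> take the value \<open>\<xi>\<close> there, and the right unit law makes it a field, with the value at
  \<open>g\<close> tangent at \<open>g\<close>.\<close>

locale smooth_unital_magma =
  fixes G :: "('g::{t2_space, second_countable_topology}, 'e::real_inner) lie_group_data"
  assumes manifold: "smooth_manifold (atlas G)"
    and mult_smooth:
      "smooth_map (prod_atlas (atlas G) (atlas G)) (atlas G) (\<lambda>(x, y). mult G x y)"
    and mult_neutral_left: "mult G (neutral G) x = x"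
    and mult_neutral_right: "mult G x (neutral G) = x"
begin

lemma left_translation_smooth: "smooth_near (atlas G) (atlas G) q (mult G g)"
proof -
  have "smooth_near (atlas G) (prod_atlas (atlas G) (atlas G)) q (\<lambda>y. (g, y))"
    by (intro smooth_near_Pair manifold smooth_near_const smooth_near_ident)
  then have "smooth_near (atlas G) (atlas G) q (\<lambda>y. (\<lambda>(x, y). mult G x y) (g, y))"
    by (rule smooth_near_compose[OF manifold smooth_manifold_prod[OF manifold manifold] manifold])
      (rule smooth_map_imp_smooth_near[OF mult_smooth])
  then show ?thesis by simp
qed

lemma mult_in_chart:
  assumes U: "(U, \<phi>) \<in> atlas G" "neutral G \<in> U"
  obtains N \<mu> where "open N" "(\<phi> (neutral G), \<phi> (neutral G)) \<in> N" "N \<subseteq> \<phi> ` U \<times> \<phi> ` U"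
    and "\<And>x y. (x, y) \<in> N \<Longrightarrow> mult G (inv_into U \<phi> x) (inv_into U \<phi> y) \<in> U"
    and "\<And>x y. (x, y) \<in> N \<Longrightarrow> \<mu> (x, y) = \<phi> (mult G (inv_into U \<phi> x) (inv_into U \<phi> y))"
    and "smooth_on N \<mu>"
proof -
  note cU = chartD[OF manifold_chart[OF manifold U(1)]]
  let ?e = "neutral G" and ?m = "\<lambda>(x, y). mult G x y"
  have "(?e, ?e) \<in> U \<times> U" "?m (?e, ?e) \<in> U" using U by (simp_all add: mult_neutral_left)
  from smooth_near_chart_iff[where f = ?m, OF smooth_manifold_prod[OF manifold manifold] manifold
      prod_atlasI[OF U(1) U(1)] this(1) U(1) this(2)]
  obtain N where N: "open N" "map_prod \<phi> \<phi> (?e, ?e) \<in> N" "N \<subseteq> map_prod \<phi> \<phi> ` (U \<times> U)"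
      "\<And>z. z \<in> N \<Longrightarrow> ?m (inv_into (U \<times> U) (map_prod \<phi> \<phi>) z) \<in> U"
    and sm: "smooth_on N (\<lambda>z. \<phi> (?m (inv_into (U \<times> U) (map_prod \<phi> \<phi>) z)))"
    using smooth_map_imp_smooth_near[OF mult_smooth] by blast
  have inv: "inv_into (U \<times> U) (map_prod \<phi> \<phi>) (x, y) = (inv_into U \<phi> x, inv_into U \<phi> y)"
    if "(x, y) \<in> N" for x y
    using that N(3) inv_into_map_prod[OF cU(6) cU(6), of "(x, y)"] by (auto simp: map_prod_image)
  show ?thesis
    by (rule that[OF N(1) _ _ _ _ sm]) (use N inv in \<open>fastforce simp: map_prod_image\<close>)+
qed

text \<open>In a chart with multiplication \<open>\<mu>\<close> and unit \<open>x\<^sub>0\<close>, the left invariant field of \<open>z\<close> is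
  \<open>Z\<^sub>z(x) = D\<mu>(x, x\<^sub>0)(0, z)\<close>, a smooth field that does not depend on the test function. The commutator of
  two such fields at \<open>x\<^sub>0\<close> is the derivative in the direction \<open>\<beta>(y, z) = DZ\<^sub>z(x\<^sub>0) y - DZ\<^sub>y(x\<^sub>0) z\<close>. Hence
  brackets of tangent vectors are tangent vectors, and the bracket inherits additivity from \<open>\<beta>\<close>.\<close>

theorem lie_bracket_in_chart:
  obtains T :: "'e \<Rightarrow> 'g tvec" and \<beta> :: "'e \<Rightarrow> 'e \<Rightarrow> 'e"
  where "linear T" "range T = lie_algebra G" "\<And>z. linear (\<lambda>y. \<beta> y z)"
    and "\<And>y z. lie_bracket G (T y) (T z) = T (\<beta> y z)"
proof -
  let ?e = "neutral G"
  obtain B :: "'e set" where B: "tight_frame B" using manifold_frame[OF manifold] .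
  obtain U \<phi> where U: "(U, \<phi>) \<in> atlas G" "?e \<in> U" using manifold_chart_at[OF manifold] .
  note cU = chartD[OF manifold_chart[OF manifold U(1)]]
  define T where "T = chart_vector (atlas G) U \<phi> ?e"
  define x0 where "x0 = \<phi> ?e"
  have inv_x0: "inv_into U \<phi> x0 = ?e" using cU(5) U by (simp add: x0_def)
  obtain M \<mu> where M: "open M" "(x0, x0) \<in> M" "M \<subseteq> \<phi> ` U \<times> \<phi> ` U"
    and multU: "\<And>x y. (x, y) \<in> M \<Longrightarrow> mult G (inv_into U \<phi> x) (inv_into U \<phi> y) \<in> U"
    and \<mu>: "\<And>x y. (x, y) \<in> M \<Longrightarrow> \<mu> (x, y) = \<phi> (mult G (inv_into U \<phi> x) (inv_into U \<phi> y))"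
    and \<mu>_smooth: "smooth_on M \<mu>"
    using mult_in_chart[OF U] unfolding x0_def by blast
  define N1 where "N1 = (\<lambda>x. (x, x0)) -` M"
  have N1: "open N1" unfolding N1_def by (intro open_vimage M continuous_intros)
  have x0N1: "x0 \<in> N1" using M by (simp add: N1_def)
  define Z where "Z = (\<lambda>z x. frechet_derivative \<mu> (at (x, x0)) (0, z))"
  have \<mu>_deriv: "(\<mu> has_derivative frechet_derivative \<mu> (at (x, x0))) (at (x, x0))" if "x \<in> N1" for x
    using smooth_on_has_derivative[OF \<mu>_smooth] that by (simp add: N1_def)
  obtain BB :: "('e \<times> 'e) set" where BB: "tight_frame BB"
    using manifold_frame[OF smooth_manifold_prod[OF manifold manifold]] .
  have Z_smooth: "smooth_on N1 (Z z)" for z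
    unfolding Z_def
    by (rule smooth_on_compose[OF BB N1 M(1) _
          smooth_on_Pair[OF N1 smooth_on_bounded_linear[OF N1 bounded_linear_ident]
            smooth_on_const[OF N1]] smooth_on_derivative[OF \<mu>_smooth]])
      (auto simp: N1_def)
  have Z_lin: "linear (\<lambda>z. Z z x)" if "x \<in> N1" for x
  proof -
    have "linear (\<lambda>z::'e. (0::'e, z))" by (auto intro!: linearI simp: zero_prod_def)
    from linear_compose[OF this has_derivative_linear[OF \<mu>_deriv[OF that]]]
    show ?thesis by (simp add: Z_def comp_def)
  qed
  have slice: "((\<lambda>y. \<mu> (x, y)) has_derivative (\<lambda>z. Z z x)) (at x0)" if "x \<in> N1" for x
    unfolding Z_def
    by (rule has_derivative_compose[where g = \<mu> and f = "\<lambda>y. (x, y)", OF _ \<mu>_deriv[OF that]])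
      (intro has_derivative_Pair has_derivative_const has_derivative_ident)
  \<comment> \<open>By the left unit law \<open>\<mu> (x0, y) = y\<close>.\<close>
  have Z_x0: "Z z x0 = z" for z
  proof -
    have "open ((\<lambda>y. (x0, y)) -` M)" by (intro open_vimage M continuous_intros)
    moreover have "\<mu> (x0, y) = y" if "y \<in> (\<lambda>y. (x0, y)) -` M" for y
      using that \<mu>[of x0 y] M(3) by (auto simp: inv_x0 mult_neutral_left f_inv_into_f)
    ultimately have "((\<lambda>y. y) has_derivative (\<lambda>z. Z z x0)) (at x0)"
      using has_derivative_transform_within_open[OF slice[OF x0N1]] M(2) by fastforce
    then have "(\<lambda>z. Z z x0) = (\<lambda>z. z)"
      using has_derivative_unique has_derivative_ident by blast
    then show ?thesis by metis
  qed
  define \<beta> where "\<beta> = (\<lambda>y z. frechet_derivative (Z z) (at x0) y - frechet_derivative (Z y) (at x0) z)"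
  have lin1: "linear (frechet_derivative (Z z) (at x0))" for z
    by (rule smooth_on_linear_derivative[OF Z_smooth x0N1])
  have lin2: "linear (\<lambda>z. frechet_derivative (Z z) (at x0) u)" for u
    by (rule linear_frechet_derivative_parameter[OF N1 x0N1 Z_lin
          smooth_on_has_derivative[OF Z_smooth x0N1]])
  have \<beta>1: "linear (\<lambda>y. \<beta> y z)" for z
    unfolding \<beta>_def by (rule linear_compose_sub[OF lin1 lin2])

  have "lie_bracket G (T y) (T z) F = T (\<beta> y z) F" for y z F
  proof (cases "smooth_near (atlas G) real_atlas ?e F")
    case False
    then show ?thesis by (simp add: lie_bracket_def T_def chart_vector_def)
  next
    case F: True
    define f where "f = (\<lambda>x. F (inv_into U \<phi> x))"
    obtain N2 where N2: "open N2" "x0 \<in> N2" "N2 \<subseteq> \<phi> ` U" and f_smooth: "smooth_on N2 f"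
      using smooth_near_real_iff[OF manifold U, of F] F unfolding f_def x0_def by blast
    obtain W where W: "open W" "?e \<in> W" "\<And>q. q \<in> W \<Longrightarrow> smooth_near (atlas G) real_atlas q F"
      by (rule smooth_near_open[OF F], rule that)
    \<comment> \<open>Points where \<open>\<mu>\<close> is defined at the unit, \<open>f\<close> is smooth, and translates of \<open>F\<close> are smooth near the unit.
      Where the last condition fails, the tangent vector returns its default value \<open>0\<close>.\<close>
    define N where "N = N1 \<inter> (N2 \<inter> inv_into U \<phi> -` W)"
    have N: "open N"
      unfolding N_def
      by (intro open_Int N1 continuous_open_preimage continuous_on_subset[OF cU(4)] N2 W)
    have x0N: "x0 \<in> N" using x0N1 N2 W by (simp add: N_def inv_x0)
    have field: "left_invariant_field G (T z) F (inv_into U \<phi> x) = frechet_derivative f (at x) (Z z x)"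
      if x: "x \<in> N" for x z
    proof -
      let ?g = "inv_into U \<phi> x"
      have xN1: "x \<in> N1" and xU: "x \<in> \<phi> ` U" and gW: "?g \<in> W" using x N2 by (auto simp: N_def)
      have "smooth_near (atlas G) real_atlas (mult G ?g ?e) F"
        using W(3)[OF gW] by (simp add: mult_neutral_right)
      then have sm: "smooth_near (atlas G) real_atlas ?e (\<lambda>y. F (mult G ?g y))"
        using smooth_near_compose[OF manifold manifold smooth_manifold_real
            left_translation_smooth] by blast
      have \<mu>x: "\<mu> (x, x0) = x"
        using \<mu>[of x x0] xN1 xU by (simp add: N1_def inv_x0 mult_neutral_right f_inv_into_f)
      have op: "open ((\<lambda>y. (x, y)) -` M)" by (intro open_vimage M continuous_intros)
      have x0M: "x0 \<in> (\<lambda>y. (x, y)) -` M" using xN1 by (simp add: N1_def)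
      have "(f has_derivative frechet_derivative f (at x)) (at (\<mu> (x, x0)))"
        unfolding \<mu>x by (rule smooth_on_has_derivative[OF f_smooth]) (use x in \<open>simp add: N_def\<close>)
      from has_derivative_compose[OF slice[OF xN1] this]
      have "((\<lambda>y. F (mult G ?g (inv_into U \<phi> y))) has_derivative
          (\<lambda>z. frechet_derivative f (at x) (Z z x))) (at x0)"
        by (rule has_derivative_transform_within_open[OF _ op x0M])
          (simp add: f_def \<mu> multU cU(5))
      then have "frechet_derivative (\<lambda>y. F (mult G ?g (inv_into U \<phi> y))) (at x0) =
          (\<lambda>z. frechet_derivative f (at x) (Z z x))"
        by (rule frechet_derivative_at[symmetric])
      then show ?thesis
        using sm by (simp add: left_invariant_field_def T_def chart_vector_def x0_def)
    qed
    have ZN: "smooth_on N (Z z)" and fN: "smooth_on N f" for z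
      by (auto intro: smooth_on_mono[OF Z_smooth] smooth_on_mono[OF f_smooth] simp: N_def)
    have field_smooth: "smooth_on N (\<lambda>x. frechet_derivative f (at x) (Z z x))" for z
      by (rule smooth_on_derivative_along_field[OF B N fN ZN])
    have field_near: "smooth_near (atlas G) real_atlas ?e (left_invariant_field G (T z) F)" for z
      unfolding smooth_near_real_iff[OF manifold U]
      using N x0N smooth_on_cong[OF N _ field_smooth[of z]] field N2
      by (intro exI[of _ N]) (auto simp: x0_def N_def)
    have twice: "T y (left_invariant_field G (T z) F) =
        frechet_derivative (\<lambda>x. frechet_derivative f (at x) (Z z x)) (at x0) y" for y z
    proof -
      have "frechet_derivative (\<lambda>x. left_invariant_field G (T z) F (inv_into U \<phi> x)) (at x0) =
          frechet_derivative (\<lambda>x. frechet_derivative f (at x) (Z z x)) (at x0)"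
        by (rule frechet_derivative_at[symmetric],
            rule has_derivative_transform_within_open[OF
              smooth_on_has_derivative[OF field_smooth x0N] N x0N])
          (simp add: field)
      then show ?thesis
        using field_near[of z] by (simp add: T_def chart_vector_def x0_def)
    qed
    have "lie_bracket G (T y) (T z) F = frechet_derivative f (at x0) (\<beta> y z)"
      using F commutator_of_derivatives_along_fields[OF B N x0N fN ZN[of y] ZN[of z]]
      by (simp add: lie_bracket_def twice Z_x0 \<beta>_def)
    then show ?thesis
      using F by (simp add: T_def chart_vector_def f_def x0_def)
  qed
  then have "lie_bracket G (T y) (T z) = T (\<beta> y z)" for y z by blast
  moreover have "linear T" unfolding T_def by (rule linear_chart_vector[OF manifold U])
  moreover have "range T = lie_algebra G"
    unfolding T_def lie_algebra_def tangent_space_eq_range[OF manifold U] ..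
  ultimately show ?thesis using that[of T \<beta>] \<beta>1 by blast
qed

lemma lie_bracket_closed:
  assumes "\<xi> \<in> lie_algebra G" "\<zeta> \<in> lie_algebra G"
  shows "lie_bracket G \<xi> \<zeta> \<in> lie_algebra G"
proof -
  obtain T :: "'e \<Rightarrow> 'g tvec" and \<beta> where T: "range T = lie_algebra G"
    and br: "\<And>y z. lie_bracket G (T y) (T z) = T (\<beta> y z)"
    by (rule lie_bracket_in_chart, rule that)
  obtain y z where "\<xi> = T y" "\<zeta> = T z" using assms unfolding T[symmetric] by blast
  then show ?thesis by (simp add: br flip: T)
qed

lemma lie_bracket_add_left:
  assumes "\<xi>1 \<in> lie_algebra G" "\<xi>2 \<in> lie_algebra G" "\<zeta> \<in> lie_algebra G"
  shows "lie_bracket G (\<xi>1 + \<xi>2) \<zeta> = lie_bracket G \<xi>1 \<zeta> + lie_bracket G \<xi>2 \<zeta>"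
proof -
  obtain T :: "'e \<Rightarrow> 'g tvec" and \<beta> where T: "linear T" "range T = lie_algebra G"
    and \<beta>: "\<And>z. linear (\<lambda>y. \<beta> y z)"
    and br: "\<And>y z. lie_bracket G (T y) (T z) = T (\<beta> y z)"
    by (rule lie_bracket_in_chart, rule that)
  obtain y1 y2 z where "\<xi>1 = T y1" "\<xi>2 = T y2" "\<zeta> = T z"
    using assms unfolding T(2)[symmetric] by blast
  moreover have "lie_bracket G (T (y1 + y2)) (T z) = T (\<beta> y1 z) + T (\<beta> y2 z)"
    by (rule trans[OF br]) (simp only: linear_add[OF \<beta>] linear_add[OF T(1)])
  ultimately show ?thesis by (simp only: linear_add[OF T(1)] br)
qed

lemma lie_bracket_antisym: "lie_bracket G \<xi> \<zeta> = - lie_bracket G \<zeta> \<xi>"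
  by (auto simp: lie_bracket_def fun_eq_iff)

end

section \<open>The Lie algebra of the cocycle double cross product\<close>

lemma lie_group_smooth_unital_magma:
  assumes "lie_group G"
  shows "smooth_unital_magma G"
proof
  obtain i where "group (mult G) (neutral G) i" using assms unfolding lie_group_def by blast
  then interpret group "mult G" "neutral G" i .
  show "mult G (neutral G) x = x" "mult G x (neutral G) = x" for x by simp_all
qed (use assms in \<open>auto simp: lie_group_def\<close>)

context cocycle_matched_pair
begin

abbreviation "D \<equiv> double_cross P"
abbreviation "MA \<equiv> base_atlas P"
abbreviation "HA \<equiv> atlas (fibre P)"

interpretation fib: smooth_unital_magma "fibre P"
  by (rule lie_group_smooth_unital_magma[OF group])

lemma atlas_double_cross: "atlas D = prod_atlas MA HA"
  and neutral_double_cross: "neutral D = (base_point P, neutral (fibre P))"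
  and mult_double_cross: "mult D x y =
    (dot P (fst x) (act P (snd x) (fst y)),
      mult (fibre P) (mult (fibre P) (gam P (fst x) (act P (snd x) (fst y))) (sig P (snd x) (fst y)))
        (snd y))"
  by (simp_all add: double_cross_def split_def)

lemma smooth_manifold_double_cross: "smooth_manifold (atlas D)"
  unfolding atlas_double_cross by (rule smooth_manifold_prod[OF manifold fib.manifold])

lemma double_cross_smooth_unital_magma: "smooth_unital_magma D"
proof
  let ?DD = "prod_atlas (atlas D) (atlas D)"
  note DM = smooth_manifold_double_cross and M = manifold and H = fib.manifold
  note DDM = smooth_manifold_prod[OF DM DM]
  show "smooth_map ?DD (atlas D) (\<lambda>(x, y). mult D x y)"
  proof (rule smooth_mapI[OF DDM DM])
    fix p
    have x: "smooth_near ?DD (atlas D) p fst" and y: "smooth_near ?DD (atlas D) p snd"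
      by (rule smooth_near_fst_snd[OF DM DM])+
    have 1: "smooth_near ?DD MA p (\<lambda>z. fst (fst z))" "smooth_near ?DD HA p (\<lambda>z. snd (fst z))"
      by (rule smooth_near_compose[OF DDM DM _ x], fact,
          simp only: atlas_double_cross smooth_near_fst_snd[OF M H])+
    have 2: "smooth_near ?DD MA p (\<lambda>z. fst (snd z))" "smooth_near ?DD HA p (\<lambda>z. snd (snd z))"
      by (rule smooth_near_compose[OF DDM DM _ y], fact,
          simp only: atlas_double_cross smooth_near_fst_snd[OF M H])+
    note act = smooth_near_compose2[OF DDM H M M act_smooth 1(2) 2(1)]
    note sig = smooth_near_compose2[OF DDM H M H sig_smooth 1(2) 2(1)]
    note dot = smooth_near_compose2[OF DDM M M M dot_smooth 1(1) act]
    note gam = smooth_near_compose2[OF DDM M M H gam_smooth 1(1) act]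
    note gs = smooth_near_compose2[OF DDM H H H fib.mult_smooth gam sig]
    note all = smooth_near_compose2[OF DDM H H H fib.mult_smooth gs 2(2)]
    show "smooth_near ?DD (atlas D) p (\<lambda>(x, y). mult D x y)"
      using smooth_near_Pair[OF DDM M H dot all]
      by (simp add: mult_double_cross split_def atlas_double_cross)
  qed
  show "mult D (neutral D) x = x" "mult D x (neutral D) = x" for x
    by (simp_all add: mult_double_cross neutral_double_cross act_neutral dot_base_left gam_base_left
        sig_neutral fib.mult_neutral_left act_base dot_base_right gam_base_right sig_base
        fib.mult_neutral_right)
qed (rule smooth_manifold_double_cross)

interpretation dc: smooth_unital_magma D
  by (rule double_cross_smooth_unital_magma)

lemma inclusion_smooth:
  "smooth_near MA (atlas D) m (\<lambda>m. (m, neutral (fibre P)))"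
  "smooth_near HA (atlas D) h (\<lambda>h. (base_point P, h))"
  unfolding atlas_double_cross
  by (intro smooth_near_Pair smooth_near_ident smooth_near_const manifold fib.manifold)+

lemma projection_smooth:
  "smooth_near (atlas D) MA p fst" "smooth_near (atlas D) HA p snd"
  unfolding atlas_double_cross by (rule smooth_near_fst_snd[OF manifold fib.manifold])+

lemma subspace_lie_algebra:
  "subspace (tangent_base P)" "subspace (lie_algebra (fibre P))" "subspace (lie_algebra D)"
  unfolding lie_algebra_def by (rule subspace_tangent_space; fact manifold fib.manifold dc.manifold)+

lemma zero_mem_tangent: "0 \<in> tangent_base P" "0 \<in> lie_algebra (fibre P)"
  by (rule subspace_0, rule subspace_lie_algebra)+

lemma join_tangent_mem:
  assumes "x \<in> dc_algebra P"
  shows "join_tangent P x \<in> lie_algebra D"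
proof -
  obtain v \<eta> where x: "x = (v, \<eta>)" and v: "v \<in> tangent_base P" and \<eta>: "\<eta> \<in> lie_algebra (fibre P)"
    using assms by (auto simp: dc_algebra_def)
  show ?thesis
    unfolding x join_tangent_def split_conv
    by (rule subspace_add[OF subspace_lie_algebra(3)])
      (use pushforward_tangent[OF manifold dc.manifold inclusion_smooth(1) v]
        pushforward_tangent[OF fib.manifold dc.manifold inclusion_smooth(2) \<eta>[unfolded lie_algebra_def]]
       in \<open>simp_all add: lie_algebra_def neutral_double_cross\<close>)
qed

lemma split_tangent_mem:
  assumes "X \<in> lie_algebra D"
  shows "split_tangent P X \<in> dc_algebra P"
  using pushforward_tangent[OF dc.manifold manifold projection_smooth(1) assms[unfolded lie_algebra_def]]
    pushforward_tangent[OF dc.manifold fib.manifold projection_smooth(2) assms[unfolded lie_algebra_def]]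
  by (simp add: split_tangent_def dc_algebra_def lie_algebra_def neutral_double_cross)

lemma join_tangent_add: "join_tangent P (x + y) = join_tangent P x + join_tangent P y"
  by (simp add: join_tangent_def split_def linear_add[OF linear_pushforward])

lemma split_tangent_add: "split_tangent P (X + Y) = split_tangent P X + split_tangent P Y"
  by (simp add: split_tangent_def linear_add[OF linear_pushforward])

lemma split_tangent_minus: "split_tangent P (- X) = - split_tangent P X"
  by (simp add: split_tangent_def linear_neg[OF linear_pushforward])

lemma dc_bracket_closed:
  "x \<in> dc_algebra P \<Longrightarrow> y \<in> dc_algebra P \<Longrightarrow> dc_bracket P x y \<in> dc_algebra P"
  unfolding dc_bracket_def by (intro split_tangent_mem dc.lie_bracket_closed join_tangent_mem)

lemma dc_bracket_antisym: "dc_bracket P x y = - dc_bracket P y x"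
  unfolding dc_bracket_def
  by (subst dc.lie_bracket_antisym) (rule split_tangent_minus)

lemma dc_bracket_add_left:
  "x \<in> dc_algebra P \<Longrightarrow> y \<in> dc_algebra P \<Longrightarrow> z \<in> dc_algebra P \<Longrightarrow>
    dc_bracket P (x + y) z = dc_bracket P x z + dc_bracket P y z"
  by (simp add: dc_bracket_def join_tangent_add dc.lie_bracket_add_left join_tangent_mem split_tangent_add)

lemma dc_bracket_add_right:
  assumes "x \<in> dc_algebra P" "y \<in> dc_algebra P" "z \<in> dc_algebra P"
  shows "dc_bracket P z (x + y) = dc_bracket P z x + dc_bracket P z y"
  using dc_bracket_add_left[OF assms] dc_bracket_antisym[of z] by simp

lemma join_tangent_fibre:
  "join_tangent P (0, \<eta>) =
    pushforward (atlas D) (\<lambda>h. (base_point P, h)) (neutral (fibre P)) \<eta>"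
  by (simp add: join_tangent_def linear_0[OF linear_pushforward])

text \<open>The function \<open>k\<close> is smooth near the unit of \<open>H\<close> exactly if \<open>k \<circ> snd\<close> is smooth near the
  unit of \<open>M \<times> H\<close>, and otherwise both sides are the default value \<open>0\<close>. It is applied with \<open>k\<close> the image
  of a function under a left invariant field.\<close>

lemma join_tangent_fibre_comp_snd:
  assumes \<eta>: "\<eta> \<in> lie_algebra (fibre P)"
  shows "join_tangent P (0, \<eta>) (\<lambda>x. k (snd x)) = \<eta> k"
proof (cases "smooth_near HA real_atlas (neutral (fibre P)) k")
  case True
  then have "smooth_near (atlas D) real_atlas (base_point P, neutral (fibre P)) (\<lambda>x. k (snd x))"
    by (intro smooth_near_compose[OF dc.manifold fib.manifold smooth_manifold_real
          projection_smooth(2)]) simp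
  then show ?thesis by (simp add: join_tangent_fibre pushforward_def comp_def)
next
  case False
  have "\<not> smooth_near (atlas D) real_atlas (base_point P, neutral (fibre P)) (\<lambda>x. k (snd x))"
    using smooth_near_compose[OF fib.manifold dc.manifold smooth_manifold_real
        inclusion_smooth(2), of "neutral (fibre P)" "\<lambda>x. k (snd x)"] False by auto
  then show ?thesis
    using False tangent_vector_not_smooth[OF \<eta>[unfolded lie_algebra_def]]
    by (simp add: join_tangent_fibre pushforward_def)
qed

text \<open>Every map of the matched pair that occurs in the product is evaluated at the base point, where it is
  normalised. This identity makes \<open>\<hh>\<close> a subalgebra.\<close>

lemma mult_fibre_right:
  "mult D g (base_point P, h) = (fst g, mult (fibre P) (snd g) h)"
  by (simp add: mult_double_cross act_base dot_base_right gam_base_right sig_base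
      fib.mult_neutral_left)

lemma left_invariant_field_fibre_fst:
  assumes \<eta>: "\<eta> \<in> lie_algebra (fibre P)"
  shows "left_invariant_field D (join_tangent P (0, \<eta>)) (\<lambda>x. f (fst x)) = (\<lambda>g. 0)"
  using tangent_vector_const[OF \<eta>[unfolded lie_algebra_def]]
  by (simp add: left_invariant_field_def join_tangent_fibre pushforward_def comp_def
      mult_fibre_right cong: if_cong)

lemma left_invariant_field_fibre_snd:
  assumes f: "smooth_near HA real_atlas (snd g) f"
  shows "left_invariant_field D (join_tangent P (0, \<eta>)) (\<lambda>x. f (snd x)) g =
    left_invariant_field (fibre P) \<eta> f (snd g)"
proof -
  have "smooth_near (atlas D) HA (neutral D) (\<lambda>x. snd (mult D g x))"
    by (rule smooth_near_compose[OF dc.manifold dc.manifold fib.manifold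
          dc.left_translation_smooth projection_smooth(2)])
  then have "smooth_near (atlas D) real_atlas (neutral D) (\<lambda>x. f (snd (mult D g x)))"
    by (rule smooth_near_compose[OF dc.manifold fib.manifold smooth_manifold_real])
      (simp add: dc.mult_neutral_right f)
  then show ?thesis
    by (simp add: left_invariant_field_def join_tangent_fibre pushforward_def comp_def
        mult_fibre_right neutral_double_cross)
qed

text \<open>The fields of \<open>\<eta>\<close> and \<open>\<kappa>\<close> kill functions of the base variable, so the component of the bracket in
  \<open>T\<^sub>o M\<close> vanishes; on functions of the fibre variable they are the fields of \<open>\<eta>\<close> and \<open>\<kappa>\<close> on \<open>H\<close>.\<close>

lemma dc_bracket_fibre:
  assumes \<eta>: "\<eta> \<in> lie_algebra (fibre P)" and \<kappa>: "\<kappa> \<in> lie_algebra (fibre P)"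
  shows "dc_bracket P (0, \<eta>) (0, \<kappa>) = (0, lie_bracket (fibre P) \<eta> \<kappa>)"
proof -
  let ?J = "\<lambda>\<eta>. join_tangent P (0, \<eta>)"
  have J: "?J \<zeta> \<in> tangent_space (atlas D) (neutral D)" if "\<zeta> \<in> lie_algebra (fibre P)" for \<zeta>
    using join_tangent_mem[of "(0, \<zeta>)"] that zero_mem_tangent by (simp add: dc_algebra_def lie_algebra_def)
  have "pushforward MA fst (neutral D) (lie_bracket D (?J \<eta>) (?J \<kappa>)) = 0"
    by (intro ext)
      (simp add: pushforward_def lie_bracket_def comp_def left_invariant_field_fibre_fst \<eta> \<kappa>
        tangent_vector_const[OF J])
  moreover have "pushforward HA snd (neutral D) (lie_bracket D (?J \<eta>) (?J \<kappa>)) f =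
      lie_bracket (fibre P) \<eta> \<kappa> f" for f
  proof (cases "smooth_near HA real_atlas (neutral (fibre P)) f")
    case False
    then show ?thesis by (simp add: pushforward_def lie_bracket_def neutral_double_cross)
  next
    case f: True
    then have sm: "smooth_near (atlas D) real_atlas (neutral D) (\<lambda>x. f (snd x))"
      by (intro smooth_near_compose[OF dc.manifold fib.manifold smooth_manifold_real
            projection_smooth(2)]) (simp add: neutral_double_cross)
    obtain W where W: "open W" "neutral (fibre P) \<in> W"
        "\<And>q. q \<in> W \<Longrightarrow> smooth_near HA real_atlas q f"
      by (rule smooth_near_open[OF f], rule that)
    have "?J \<zeta> (left_invariant_field D (?J \<zeta>') (\<lambda>x. f (snd x))) =
        \<zeta> (left_invariant_field (fibre P) \<zeta>' f)" if "\<zeta> \<in> lie_algebra (fibre P)" for \<zeta> \<zeta>'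
    proof -
      have "?J \<zeta> (left_invariant_field D (?J \<zeta>') (\<lambda>x. f (snd x))) =
          ?J \<zeta> (\<lambda>g. left_invariant_field (fibre P) \<zeta>' f (snd g))"
      proof (rule tangent_vector_local[OF dc.manifold J[OF that]])
        show "open (UNIV \<times> W)" "neutral D \<in> UNIV \<times> W"
          using W by (simp_all add: open_Times neutral_double_cross)
        show "left_invariant_field D (?J \<zeta>') (\<lambda>x. f (snd x)) g =
            left_invariant_field (fibre P) \<zeta>' f (snd g)" if "g \<in> UNIV \<times> W" for g
          using that by (intro left_invariant_field_fibre_snd W) auto
      qed
      then show ?thesis by (simp only: join_tangent_fibre_comp_snd[OF that])
    qed
    then show ?thesis
      using f sm \<eta> \<kappa> by (simp add: pushforward_def lie_bracket_def neutral_double_cross comp_def)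
  qed
  ultimately show ?thesis by (auto simp: dc_bracket_def split_tangent_def fun_eq_iff)
qed

lemma dc_bracket_base:
  assumes "v \<in> tangent_base P" "\<eta> \<in> lie_algebra (fibre P)" "w \<in> tangent_base P"
  shows "dc_bracket P (v, \<eta>) (w, 0) =
    (base_bracket P v w, inf_theta P v w) + (inf_act P \<eta> w, inf_psi P \<eta> w)"
  using dc_bracket_add_left[of "(v, 0)" "(0, \<eta>)" "(w, 0)"] assms zero_mem_tangent
  by (simp add: dc_algebra_def base_bracket_def inf_theta_def inf_act_def inf_psi_def)

lemma dc_bracket_fibre_right:
  assumes "v \<in> tangent_base P" "\<eta> \<in> lie_algebra (fibre P)" "\<kappa> \<in> lie_algebra (fibre P)"
  shows "dc_bracket P (v, \<eta>) (0, \<kappa>) =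
    (0, lie_bracket (fibre P) \<eta> \<kappa>) + - (inf_act P \<kappa> v, inf_psi P \<kappa> v)"
  using dc_bracket_add_left[of "(v, 0)" "(0, \<eta>)" "(0, \<kappa>)"] assms zero_mem_tangent
    dc_bracket_antisym[of "(v, 0)" "(0, \<kappa>)"] dc_bracket_fibre[of \<eta> \<kappa>]
  by (simp add: dc_algebra_def inf_act_def inf_psi_def)

end

section \<open>The Euler-Poincare equations\<close>

text \<open>In the linear coordinates \<open>L\<close> the directional derivatives of \<open>l\<close> are values of one Frechet derivative.\<close>

lemma vderiv_lagrangian_add:
  fixes P :: "('m::topological_space, 'e::real_inner, 'h::topological_space, 'f::real_inner)
    matched_pair_data"
  assumes "lagrangian P l" "x \<in> dc_algebra P" "y \<in> dc_algebra P" "z \<in> dc_algebra P"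
  shows "vderiv l x (y + z) = vderiv l x y + vderiv l x z"
proof -
  obtain L :: "'e \<times> 'f \<Rightarrow> 'm tvec \<times> 'h tvec" where L: "linear L" "bij_betw L UNIV (dc_algebra P)"
    and diff: "\<And>x. (l \<circ> L) differentiable (at x)"
    using assms(1) unfolding lagrangian_def by blast
  have surj: "\<exists>a. x = L a" if "x \<in> dc_algebra P" for x
    using bij_betw_imp_surj_on[OF L(2)] that by blast
  obtain a b c where abc: "x = L a" "y = L b" "z = L c" using surj assms(2-4) by metis
  let ?D = "frechet_derivative (l \<circ> L) (at a)"
  have D: "((l \<circ> L) has_derivative ?D) (at a)"
    using diff[of a] unfolding frechet_derivative_works .
  have "vderiv l (L a) (L b) = ?D b" for b
  proof -
    have "((\<lambda>s. (l \<circ> L) (a + s *\<^sub>R b)) has_real_derivative ?D b) (at 0)"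
      by (rule has_real_derivative_along_line) (use D in \<open>simp add: comp_def\<close>)
    then show ?thesis
      by (simp add: vderiv_def comp_def linear_add[OF L(1)] linear_cmul[OF L(1)] DERIV_imp_deriv)
  qed
  then show ?thesis
    using linear_add[OF has_derivative_linear[OF D]]
    by (simp add: abc flip: linear_add[OF L(1)])
qed

theorem corollary3p3:
  fixes P :: "('m::{t2_space, second_countable_topology}, 'e::real_inner,
      'h::{t2_space, second_countable_topology}, 'f::real_inner) matched_pair_data"
    and l :: "'m tvec \<times> 'h tvec \<Rightarrow> real"
    and v :: "real \<Rightarrow> 'm tvec" and \<eta> :: "real \<Rightarrow> 'h tvec"
    and I :: "real set" and t :: real
    and dl_v :: "real \<Rightarrow> 'm covec" and dl_\<eta> :: "real \<Rightarrow> 'h covec"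
  assumes "cocycle_matched_pair P"
    and "lagrangian P l"
    and "is_interval I"
    and "\<And>s. s \<in> I \<Longrightarrow> v s \<in> tangent_base P"
    and "\<And>s. s \<in> I \<Longrightarrow> \<eta> s \<in> lie_algebra (fibre P)"
    and "t \<in> I"
  defines "dl_v \<equiv> \<lambda>s. vderiv (\<lambda>u. l (u, \<eta> s)) (v s)"
    and "dl_\<eta> \<equiv> \<lambda>s. vderiv (\<lambda>\<kappa>. l (v s, \<kappa>)) (\<eta> s)"
  shows "euler_poincare (dc_algebra P) (dc_bracket P) l (\<lambda>s. (v s, \<eta> s)) t I \<longleftrightarrow>
    dual_deriv (tangent_base P) dl_v
      (- coad (base_bracket P) (v t) (dl_v t) + coact P (dl_v t) (\<eta> t)
        + transpose_map (map_a P (\<eta> t)) (dl_\<eta> t) + transpose_map (map_theta P (v t)) (dl_\<eta> t)) t I \<and>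
    dual_deriv (lie_algebra (fibre P)) dl_\<eta>
      (- coad (lie_bracket (fibre P)) (\<eta> t) (dl_\<eta> t)
        - transpose_map (map_b P (v t)) (dl_v t) - transpose_map (map_psi P (v t)) (dl_\<eta> t)) t I"
    (is "?EP \<longleftrightarrow> dual_deriv _ _ ?A _ _ \<and> dual_deriv _ _ ?C _ _")
proof -
  interpret cocycle_matched_pair P by fact
  let ?\<xi> = "\<lambda>s. (v s, \<eta> s)" and ?dl = "\<lambda>s. vderiv l (v s, \<eta> s)"
  note zero = zero_mem_tangent
  have v: "v t \<in> tangent_base P" and \<eta>: "\<eta> t \<in> lie_algebra (fibre P)"
    using assms by auto
  have \<xi>: "?\<xi> s \<in> dc_algebra P" if "s \<in> I" for s using that assms by (simp add: dc_algebra_def)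
  have partial: "?dl s (w, 0) = dl_v s w" "?dl s (0, \<kappa>) = dl_\<eta> s \<kappa>" for s w \<kappa>
    by (simp_all add: dl_v_def dl_\<eta>_def vderiv_def)
  have add: "?dl s (y + z) = ?dl s y + ?dl s z"
    if "s \<in> I" "y \<in> dc_algebra P" "z \<in> dc_algebra P" for s y z
    by (rule vderiv_lagrangian_add[OF assms(2) \<xi>]) (use that in auto)
  have total: "?dl s (w, \<kappa>) = dl_v s w + dl_\<eta> s \<kappa>"
    if "s \<in> I" "(w, \<kappa>) \<in> dc_algebra P" for s w \<kappa>
    using add[of s "(w, 0)" "(0, \<kappa>)"] that zero by (simp add: partial dc_algebra_def)
  have neg: "?dl t (- y) = - ?dl t y" if y: "y \<in> dc_algebra P" for y
  proof -
    have ny: "- y \<in> dc_algebra P"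
      using y subspace_neg[OF subspace_lie_algebra(1)] subspace_neg[OF subspace_lie_algebra(2)]
      by (auto simp: dc_algebra_def)
    have "?dl t (0 + 0) = ?dl t 0 + ?dl t 0"
      by (rule add) (use zero assms(6) in \<open>auto simp: dc_algebra_def zero_prod_def\<close>)
    then have "?dl t (y + - y) = 0" by simp
    then show ?thesis using add[OF assms(6) y ny] by simp
  qed
  \<comment> \<open>The derivative of \<open>l\<close> is known to be additive only on \<open>T\<^sub>o M \<oplus> \<hh>\<close>, so the brackets have to lie there.\<close>
  have pairs: "(base_bracket P a b, inf_theta P a b) \<in> dc_algebra P"
      "(inf_act P \<kappa> a, inf_psi P \<kappa> a) \<in> dc_algebra P"
    if "a \<in> tangent_base P" "b \<in> tangent_base P" "\<kappa> \<in> lie_algebra (fibre P)" for a b \<kappa>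
    using dc_bracket_closed[of "(a, 0)" "(b, 0)"] dc_bracket_closed[of "(0, \<kappa>)" "(a, 0)"] that zero
    by (simp_all add: base_bracket_def inf_theta_def inf_act_def inf_psi_def dc_algebra_def)
  have A: "?dl t (dc_bracket P (?\<xi> t) (w, 0)) = ?A w" if w: "w \<in> tangent_base P" for w
    unfolding dc_bracket_base[OF v \<eta> w]
    by (subst add)
      (use w v \<eta> pairs assms(6) in \<open>auto simp: total coad_def coact_def transpose_map_def
        map_a_def map_theta_def\<close>)
  have C: "?dl t (dc_bracket P (?\<xi> t) (0, \<kappa>)) = ?C \<kappa>" if \<kappa>: "\<kappa> \<in> lie_algebra (fibre P)" for \<kappa>
  proof -
    have act: "(inf_act P \<kappa> (v t), inf_psi P \<kappa> (v t)) \<in> dc_algebra P"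
      and br: "(0, lie_bracket (fibre P) (\<eta> t) \<kappa>) \<in> dc_algebra P"
      using pairs(2)[OF v v \<kappa>] dc_bracket_closed[of "(0, \<eta> t)" "(0, \<kappa>)"] dc_bracket_fibre[OF \<eta> \<kappa>]
        \<eta> \<kappa> zero by (simp_all add: dc_algebra_def)
    have nact: "- (inf_act P \<kappa> (v t), inf_psi P \<kappa> (v t)) \<in> dc_algebra P"
      using act subspace_neg[OF subspace_lie_algebra(1)] subspace_neg[OF subspace_lie_algebra(2)]
      by (auto simp: dc_algebra_def)
    have "?dl t (dc_bracket P (?\<xi> t) (0, \<kappa>)) = ?dl t (0, lie_bracket (fibre P) (\<eta> t) \<kappa>)
        + - ?dl t (inf_act P \<kappa> (v t), inf_psi P \<kappa> (v t))"
      unfolding dc_bracket_fibre_right[OF v \<eta> \<kappa>] add[OF assms(6) br nact] neg[OF act] ..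
    then show ?thesis
      unfolding partial total[OF assms(6) act]
      by (simp add: coad_def transpose_map_def map_b_def map_psi_def)
  qed
  have "?EP \<longleftrightarrow> (\<forall>y\<in>dc_algebra P.
      ((\<lambda>s. ?dl s y) has_real_derivative ?dl t (dc_bracket P (?\<xi> t) y)) (at t within I))"
    by (simp add: euler_poincare_def dual_deriv_def coad_def)
  also have "\<dots> \<longleftrightarrow> dual_deriv (tangent_base P) dl_v ?A t I \<and>
      dual_deriv (lie_algebra (fibre P)) dl_\<eta> ?C t I" (is "?l \<longleftrightarrow> ?r")
  proof
    assume l: ?l
    have "((\<lambda>s. dl_v s w) has_real_derivative ?A w) (at t within I)" if w: "w \<in> tangent_base P" for w
      using bspec[OF l, of "(w, 0)"] w zero unfolding A[OF w] partial by (simp add: dc_algebra_def)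
    moreover have "((\<lambda>s. dl_\<eta> s \<kappa>) has_real_derivative ?C \<kappa>) (at t within I)"
      if \<kappa>: "\<kappa> \<in> lie_algebra (fibre P)" for \<kappa>
      using bspec[OF l, of "(0, \<kappa>)"] \<kappa> zero unfolding C[OF \<kappa>] partial by (simp add: dc_algebra_def)
    ultimately show ?r unfolding dual_deriv_def by blast
  next
    assume r: ?r
    show ?l
    proof
      fix y assume y: "y \<in> dc_algebra P"
      obtain w \<kappa> where y_eq: "y = (w, \<kappa>)" and w: "w \<in> tangent_base P"
        and \<kappa>: "\<kappa> \<in> lie_algebra (fibre P)"
        using y by (auto simp: dc_algebra_def)
      have mem: "(w, 0) \<in> dc_algebra P" "(0, \<kappa>) \<in> dc_algebra P"
        using w \<kappa> zero by (simp_all add: dc_algebra_def)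
      have "dc_bracket P (?\<xi> t) y = dc_bracket P (?\<xi> t) (w, 0) + dc_bracket P (?\<xi> t) (0, \<kappa>)"
        using dc_bracket_add_right[OF mem \<xi>[OF assms(6)]] by (simp add: y_eq)
      then have "?dl t (dc_bracket P (?\<xi> t) y) = ?A w + ?C \<kappa>"
        using add[OF assms(6) dc_bracket_closed[OF \<xi>[OF assms(6)] mem(1)]
            dc_bracket_closed[OF \<xi>[OF assms(6)] mem(2)]] A[OF w] C[OF \<kappa>]
        by (simp only:)
      moreover have "((\<lambda>s. dl_v s w + dl_\<eta> s \<kappa>) has_real_derivative ?A w + ?C \<kappa>) (at t within I)"
        using r w \<kappa> unfolding dual_deriv_def by (intro DERIV_add) auto
      ultimately show "((\<lambda>s. ?dl s y) has_real_derivative ?dl t (dc_bracket P (?\<xi> t) y)) (at t within I)"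
        using total y
        by (auto simp only: y_eq intro: has_field_derivative_transform_within[OF _ zero_less_one assms(6)])
    qed
  qed
  finally show ?thesis .
qed

end
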